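(* Let $R\in(0,1]$, let $N\ge 1$ be an integer, $\alpha\in\mathbb{R}$, and let $B_R^+=B_R\cap\mathbb{R}^N_+$. Let $u\ge 0$ be a distributional solution to $$-\Delta u-\frac{N^2}{4}|x|^{-2}u\ \ge\ \alpha\,|x|^{-2}\bigl|\log|x|\bigr|^{-2}u\qquad\text{in }\mathcal{D}'(B_R^+).$$ Assume that there exists $\gamma\le 1$ such that $$u\in L^2\bigl(B_R^+;|x|^{-2}\bigl|\log|x|\bigr|^{-2\gamma}\,dx\bigr),\qquad \alpha\ge\frac14-(1-\gamma)^2.$$ Then $u=0$ almost everywhere in $B_R^+$.
   Context: $B_R$ is the open ball of radius $R$ in $\mathbb{R}^N$ centered at $0$, and $\mathbb{R}^N_+$ is any open half-space of $\mathbb{R}^N$ with $0$ on its boundary; for $N=1$, $B_R^+=(0,R)$ or $B_R^+=(-R,0)$. A distributional solution is a function $u\in L^1_{\rm loc}(B_R^+)$ such that $$-\int_{B_R^+}u\,\Delta\varphi\,dx-\frac{N^2}{4}\int_{B_R^+}|x|^{-2}u\varphi\,dx\ \ge\ \alpha\int_{B_R^+}|x|^{-2}\bigl|\log|x|\bigr|^{-2}u\varphi\,dx$$ for every non-negative $\varphi\in C^\infty_c(B_R^+)$. For a non-negative measurable weight $\omega$, $L^2(\Omega;\omega(x)\,dx)$ is the space of measurable $u$ on $\Omega$ with $\int_\Omega|u|^2\omega\,dx<\infty$. *)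

theory Defs
  imports "HOL-Analysis.Analysis"
begin

definition partial_deriv :: "'a::euclidean_space \<Rightarrow> ('a \<Rightarrow> real) \<Rightarrow> 'a \<Rightarrow> real" where
  "partial_deriv b f x = frechet_derivative f (at x) b"

definition laplacian :: "('a::euclidean_space \<Rightarrow> real) \<Rightarrow> 'a \<Rightarrow> real" where
  "laplacian f x = (\<Sum>b\<in>Basis. partial_deriv b (partial_deriv b f) x)"

primrec C_k :: "nat \<Rightarrow> ('a::euclidean_space \<Rightarrow> real) \<Rightarrow> bool" where
  "C_k 0 f \<longleftrightarrow> continuous_on UNIV f"
| "C_k (Suc k) f \<longleftrightarrow> (\<forall>x. f differentiable (at x)) \<and> (\<forall>b\<in>Basis. C_k k (partial_deriv b f))"

(* Elements of C_c^infinity(\<Omega>), \<Omega> open, are represented by their extension by zero to the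
   whole space, which is again smooth. *)
definition test_function_on :: "'a::euclidean_space set \<Rightarrow> ('a \<Rightarrow> real) \<Rightarrow> bool" where
  "test_function_on \<Omega> \<phi> \<longleftrightarrow>
     (\<forall>k. C_k k \<phi>) \<and> compact (closure {x. \<phi> x \<noteq> 0}) \<and> closure {x. \<phi> x \<noteq> 0} \<subseteq> \<Omega>"

(* Functions on \<Omega> are total functions of which only the values on \<Omega> matter. *)
definition L1_loc :: "'a::euclidean_space set \<Rightarrow> ('a \<Rightarrow> real) set" where
  "L1_loc \<Omega> = {u. \<forall>K. compact K \<and> K \<subseteq> \<Omega> \<longrightarrow> u absolutely_integrable_on K}"

definition weighted_L2 :: "'a::euclidean_space set \<Rightarrow> ('a \<Rightarrow> real) \<Rightarrow> ('a \<Rightarrow> real) set" where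
  "weighted_L2 \<Omega> \<omega> =
     {u. u \<in> borel_measurable (lebesgue_on \<Omega>) \<and>
         (\<integral>\<^sup>+x. ennreal (\<bar>u x\<bar>\<^sup>2 * \<omega> x) \<partial>lebesgue_on \<Omega>) < \<infinity>}"

(* The intersection of B_R with the open half-space of inner normal \<nu>, where \<nu> is nonzero. *)
definition half_ball :: "'a::euclidean_space \<Rightarrow> real \<Rightarrow> 'a set" where
  "half_ball \<nu> R = ball 0 R \<inter> {x. \<nu> \<bullet> x > 0}"

definition distributional_solution ::
    "'a::euclidean_space set \<Rightarrow> real \<Rightarrow> ('a \<Rightarrow> real) \<Rightarrow> bool" where
  "distributional_solution \<Omega> \<alpha> u \<longleftrightarrow>
     u \<in> L1_loc \<Omega> \<and>
     (\<forall>\<phi>. test_function_on \<Omega> \<phi> \<and> (\<forall>x. \<phi> x \<ge> 0) \<longrightarrow>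
        - (LINT x:\<Omega>|lebesgue. u x * laplacian \<phi> x)
        - (real DIM('a))\<^sup>2 / 4 * (LINT x:\<Omega>|lebesgue. norm x powi (-2) * u x * \<phi> x)
        \<ge> \<alpha> * (LINT x:\<Omega>|lebesgue. norm x powi (-2) * \<bar>ln (norm x)\<bar> powi (-2) * u x * \<phi> x))"

end

theory Submission
  imports Defs
begin

text \<open>
  Put $t = -\log|x|$, $z = \nu\cdot x$ and $\beta = 1-\gamma \ge 0$; as $u \ge 0$, we may lower
  $\alpha$ to $1/4-\beta^2$. The function $z$ is harmonic, positive and vanishes on the flat boundary, so
  $z\,|x|^{-N/2}\psi(t)$ with $\psi \ge 0$ compactly supported is the natural test function.
  Replacing $z$ by $G_n(z)$ with $G_n$ convex and zero near $0$ makes it admissible, and $G_n'' \ge 0$ lets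
  one drop the only term that blows up as $G_n(z) \to z$. The limit is the ODE inequality
  $$\int u\,z\,|x|^{-N/2-2}\,\bigl(\psi'' + (1/4-\beta^2)\,t^{-2}\psi\bigr)(t)\,dx \le 0.$$
  Writing $\psi = t^{1/2+\beta} q$ turns the bracket into $t^{-1/2-\beta}\,(t^{1+2\beta}q')'$. Choose
  $t^{1+2\beta}q' = W$, where $W$ rises from $0$ to $1$ on $[a,a+1]$ and falls back on $[K,2K]$, and
  cut $q$ off on $[L,2L]$. By weighted AM-GM and the $L^2$ hypothesis, the mass
  $\int_{t\in[A,2A]} u\,z\,|x|^{-N/2-2}\,dx$ is $o(A^{3/2-\beta})$, which is exactly what kills
  the error terms when first $L\to\infty$ and then $K\to\infty$. Hence $u$ vanishes
  where $a < t < a+1$, for every $a > -\log R$.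
\<close>

section \<open>Smooth functions of one real variable\<close>

text \<open>On functions z f(|x|) the Laplacian acts as the radial Laplacian in dimension N + 2,
  whose Hardy constant is N^2/4. This is why the critical power |x|^(-N/2) absorbs the Hardy
  potential and leaves only psi'' in the variable t. In turn 1/4 is the Hardy constant of the
  half-line: t^(1/2+\<beta>) and t^(1/2-\<beta>) solve psi'' + (1/4 - \<beta>^2) t^(-2) psi = 0, and
  dividing by the first one produces the factorised bracket. The obstacle is that no nonzero psi
  \<ge> 0 of compact support in t > 0 makes the bracket nonnegative: pairing it with t^(1/2-\<beta>)
  and integrating by parts gives zero. Negative errors are unavoidable and are pushed far out. Their
  sizes K^(-3/2-\<beta>) and L^(\<beta>-3/2) meet a mass of order A^(3/2-\<beta>), so in the second
  product, and for \<beta> = 0 also in the first, no power is left over: smallness comes only from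
  the little-o, that is, from the tail of a convergent integral. Letting W fall back before the
  cut-off keeps q constant where the cut-off acts, so the two derivatives never meet.\<close>

definition smooth_real :: "real set \<Rightarrow> (real \<Rightarrow> real) \<Rightarrow> bool" where
  "smooth_real S f \<longleftrightarrow> (\<forall>k. \<forall>x\<in>S. (deriv ^^ k) f field_differentiable at x)"

text \<open>Smoothness is a greatest fixed point, so a family closed under differentiation replaces
  any formula for the k-th derivative. Openness of \<open>S\<close> is what lets an equality on
  \<open>S\<close> pass to derivatives.\<close>

lemma smooth_real_coinduct:
  assumes "open S" "f \<in> F"
    and step: "\<And>f. f \<in> F \<Longrightarrow> \<exists>f'\<in>F. \<forall>x\<in>S. (f has_real_derivative f' x) (at x)"
  shows "smooth_real S f"
proof -
  have "\<exists>g\<in>F. \<forall>x\<in>S. (deriv ^^ k) f x = g x" for k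
  proof (induction k)
    case 0
    then show ?case using assms(2) by auto
  next
    case (Suc k)
    then obtain g where g: "g \<in> F" "\<forall>x\<in>S. (deriv ^^ k) f x = g x" by blast
    obtain g' where g': "g' \<in> F" "\<forall>x\<in>S. (g has_real_derivative g' x) (at x)"
      using step[OF g(1)] by blast
    have "((deriv ^^ k) f has_real_derivative g' x) (at x)" if "x \<in> S" for x
      using has_field_derivative_transform_within_open[OF bspec[OF g'(2) that] \<open>open S\<close> that] g(2)
      by auto
    then have "\<forall>x\<in>S. (deriv ^^ Suc k) f x = g' x" by (auto intro: DERIV_imp_deriv)
    then show ?case using g'(1) by blast
  qed
  note ev = this
  show ?thesis unfolding smooth_real_def
  proof (intro allI ballI)
    fix k x assume x: "x \<in> S"
    obtain g where g: "g \<in> F" "\<forall>x\<in>S. (deriv ^^ k) f x = g x" using ev by blast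
    obtain g' where g': "g' \<in> F" "\<forall>x\<in>S. (g has_real_derivative g' x) (at x)"
      using step[OF g(1)] by blast
    show "(deriv ^^ k) f field_differentiable at x"
      using has_field_derivative_transform_within_open[OF bspec[OF g'(2) x] \<open>open S\<close> x] g(2)
      unfolding field_differentiable_def by metis
  qed
qed

lemma smooth_real_deriv: "smooth_real S f \<Longrightarrow> smooth_real S (deriv f)"
  unfolding smooth_real_def by (metis funpow_Suc_right o_apply)

lemma smooth_real_DERIV: "smooth_real S f \<Longrightarrow> x \<in> S \<Longrightarrow> (f has_real_derivative deriv f x) (at x)"
  unfolding smooth_real_def using field_differentiable_derivI by (metis funpow_0)

text \<open>Differentiability is demanded in the full filter \<open>at x\<close>, so the notion is
  pointwise in \<open>S\<close> and gluing needs no compatibility condition. Functions involving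
  \<open>powr\<close> or \<open>ln\<close> are later made smooth on the whole line in this
  way.\<close>

lemma smooth_real_Un: "smooth_real S f \<Longrightarrow> smooth_real T f \<Longrightarrow> smooth_real (S \<union> T) f"
  unfolding smooth_real_def by auto

lemma smooth_real_subset: "smooth_real S f \<Longrightarrow> T \<subseteq> S \<Longrightarrow> smooth_real T f"
  unfolding smooth_real_def by auto

lemma smooth_real_cong:
  assumes "open S" "smooth_real S f" "\<And>x. x \<in> S \<Longrightarrow> f x = g x"
  shows "smooth_real S g"
proof (rule smooth_real_coinduct[where F = "{g. \<exists>f. smooth_real S f \<and> (\<forall>x\<in>S. f x = g x)}"])
  fix g assume "g \<in> {g. \<exists>f. smooth_real S f \<and> (\<forall>x\<in>S. f x = g x)}"
  then obtain f where f: "smooth_real S f" "\<forall>x\<in>S. f x = g x" by blast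
  have "\<forall>x\<in>S. (g has_real_derivative deriv f x) (at x)"
    using has_field_derivative_transform_within_open[OF smooth_real_DERIV[OF f(1)] \<open>open S\<close>] f(2)
    by blast
  then show "\<exists>f'\<in>{g. \<exists>f. smooth_real S f \<and> (\<forall>x\<in>S. f x = g x)}.
      \<forall>x\<in>S. (g has_real_derivative f' x) (at x)"
    using smooth_real_deriv[OF f(1)] by blast
qed (use assms in auto)

lemma smooth_real_antideriv:
  assumes "open S" "smooth_real S f" "\<And>x. x \<in> S \<Longrightarrow> (F has_real_derivative f x) (at x)"
  shows "smooth_real S F"
  by (rule smooth_real_coinduct[where F = "insert F {f. smooth_real S f}"])
     (use assms(1) in \<open>auto intro: assms(2,3) smooth_real_deriv smooth_real_DERIV\<close>)

lemma smooth_real_const: "smooth_real UNIV (\<lambda>_. c)"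
proof (rule smooth_real_coinduct[where F = "range (\<lambda>c _. c)"])
  fix f :: "real \<Rightarrow> real" assume "f \<in> range (\<lambda>c _. c)"
  then obtain c where "f = (\<lambda>_. c)" by blast
  then show "\<exists>f'\<in>range (\<lambda>c _. c). \<forall>x\<in>UNIV. (f has_real_derivative f' x) (at x)"
    by (intro bexI[where x = "\<lambda>_. 0"]) auto
qed auto

lemma smooth_real_id: "smooth_real UNIV (\<lambda>x. x)"
  by (rule smooth_real_antideriv[OF _ smooth_real_const[of 1]]) auto

text \<open>The derivative of a composition is a product of a composition and a derivative, and
  products bring in sums. This is the class those rules generate, so coinduction applies and higher
  Leibniz or chain formulas are avoided. The outer function lives on its own set \<open>T\<close>,
  to admit functions smooth only on a half-line.\<close>

inductive_set smooth_hull :: "real set \<Rightarrow> (real \<Rightarrow> real) set" for S where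
  comp: "smooth_real T f \<Longrightarrow> smooth_real S g \<Longrightarrow> g ` S \<subseteq> T \<Longrightarrow> (\<lambda>x. f (g x)) \<in> smooth_hull S"
| add: "f \<in> smooth_hull S \<Longrightarrow> g \<in> smooth_hull S \<Longrightarrow> (\<lambda>x. f x + g x) \<in> smooth_hull S"
| mult: "f \<in> smooth_hull S \<Longrightarrow> g \<in> smooth_hull S \<Longrightarrow> (\<lambda>x. f x * g x) \<in> smooth_hull S"

lemma smooth_hull_base: "smooth_real S f \<Longrightarrow> f \<in> smooth_hull S"
  using smooth_hull.comp[OF smooth_real_id, of S f] by simp

lemma smooth_hull_smooth:
  assumes "open S" "f \<in> smooth_hull S"
  shows "smooth_real S f"
proof (rule smooth_real_coinduct[OF assms])
  fix f assume "f \<in> smooth_hull S"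
  then show "\<exists>f'\<in>smooth_hull S. \<forall>x\<in>S. (f has_real_derivative f' x) (at x)"
  proof induction
    case (comp T f g)
    have "(\<lambda>x. deriv f (g x) * deriv g x) \<in> smooth_hull S"
      using comp by (intro smooth_hull.mult[OF smooth_hull.comp[of T "deriv f"] smooth_hull_base]
          smooth_real_deriv)
    moreover have "\<forall>x\<in>S. ((\<lambda>x. f (g x)) has_real_derivative deriv f (g x) * deriv g x) (at x)"
      by (intro ballI DERIV_chain2[OF smooth_real_DERIV[OF comp(1)] smooth_real_DERIV[OF comp(2)]])
         (use comp(3) in auto)
    ultimately show ?case by (intro bexI[where x = "\<lambda>x. deriv f (g x) * deriv g x"])
  next
    case (add f g)
    then obtain f' g' where *: "f' \<in> smooth_hull S" "\<forall>x\<in>S. (f has_real_derivative f' x) (at x)"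
      "g' \<in> smooth_hull S" "\<forall>x\<in>S. (g has_real_derivative g' x) (at x)" by blast
    have "\<forall>x\<in>S. ((\<lambda>x. f x + g x) has_real_derivative f' x + g' x) (at x)"
      using * by (auto intro!: derivative_eq_intros)
    then show ?case by (intro bexI[where x = "\<lambda>x. f' x + g' x"] smooth_hull.add * )
  next
    case (mult f g)
    then obtain f' g' where *: "f' \<in> smooth_hull S" "\<forall>x\<in>S. (f has_real_derivative f' x) (at x)"
      "g' \<in> smooth_hull S" "\<forall>x\<in>S. (g has_real_derivative g' x) (at x)" by blast
    have "\<forall>x\<in>S. ((\<lambda>x. f x * g x) has_real_derivative f' x * g x + g' x * f x) (at x)"
      using * by (auto intro!: DERIV_mult)
    then show ?case by (intro bexI[where x = "\<lambda>x. f' x * g x + g' x * f x"] smooth_hull.add smooth_hull.mult * mult)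
  qed
qed

lemma smooth_real_comp:
  "open S \<Longrightarrow> smooth_real T f \<Longrightarrow> smooth_real S g \<Longrightarrow> g ` S \<subseteq> T \<Longrightarrow> smooth_real S (\<lambda>x. f (g x))"
  by (rule smooth_hull_smooth, assumption, rule smooth_hull.comp)

lemma smooth_real_add:
  "open S \<Longrightarrow> smooth_real S f \<Longrightarrow> smooth_real S g \<Longrightarrow> smooth_real S (\<lambda>x. f x + g x)"
  by (blast intro: smooth_hull_smooth[OF _ smooth_hull.add[OF smooth_hull_base smooth_hull_base]])

lemma smooth_real_mult:
  "open S \<Longrightarrow> smooth_real S f \<Longrightarrow> smooth_real S g \<Longrightarrow> smooth_real S (\<lambda>x. f x * g x)"
  by (blast intro: smooth_hull_smooth[OF _ smooth_hull.mult[OF smooth_hull_base smooth_hull_base]])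

section \<open>Concrete smooth functions: affine maps, powers, logarithm, flat functions\<close>

lemma smooth_real_affine: "smooth_real UNIV (\<lambda>x. c * x + d)"
  by (intro smooth_real_add smooth_real_mult smooth_real_const smooth_real_id open_UNIV)

lemma smooth_real_comp_affine: "smooth_real UNIV f \<Longrightarrow> smooth_real UNIV (\<lambda>x. f (c * x + d))"
  by (rule smooth_real_comp[OF _ _ smooth_real_affine]) auto

lemma smooth_real_powr: "smooth_real {0<..} (\<lambda>x. x powr a)"
proof (rule smooth_real_coinduct[where F = "range (\<lambda>(c, a) x. c * x powr a)"])
  fix f :: "real \<Rightarrow> real" assume "f \<in> range (\<lambda>(c, a) x. c * x powr a)"
  then obtain c a where f: "f = (\<lambda>x. c * x powr a)" by auto
  have "\<forall>x\<in>{0<..}. (f has_real_derivative (c * a) * x powr (a - 1)) (at x)"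
    unfolding f by (auto intro!: derivative_eq_intros)
  then show "\<exists>f'\<in>range (\<lambda>(c, a) x. c * x powr a). \<forall>x\<in>{0<..}. (f has_real_derivative f' x) (at x)"
    by (intro bexI[where x = "\<lambda>x. (c * a) * x powr (a - 1)"]) (auto intro!: range_eqI[where x = "(c * a, a - 1)"])
qed (auto intro!: range_eqI[where x = "(1, a)"])

lemma smooth_real_ln: "smooth_real {0<..} ln"
proof (rule smooth_real_antideriv[OF _ smooth_real_powr[of "-1"]])
  fix x :: real assume "x \<in> {0<..}"
  then show "(ln has_real_derivative x powr - 1) (at x)"
    by (auto intro!: derivative_eq_intros simp: powr_minus field_simps)
qed auto

text \<open>The class of combinations of $x^{-k} e^{-1/x}$ is closed under differentiation, also at the
  origin.\<close>

definition flat_fun :: "nat \<Rightarrow> real \<Rightarrow> real" where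
  "flat_fun k x = (if x \<le> 0 then 0 else inverse x ^ k * exp (- inverse x))"

text \<open>From the right, y = 1/x tends to infinity and exp beats every power; from the left the
  function vanishes.\<close>

lemma flat_fun_tendsto: "(flat_fun k \<longlongrightarrow> 0) (at 0)"
proof -
  have "((\<lambda>x::real. inverse x ^ k / exp (inverse x)) \<longlongrightarrow> 0) (at_right 0)"
    by (rule filterlim_compose[OF tendsto_power_div_exp_0 filterlim_inverse_at_top_right])
  then have r: "(flat_fun k \<longlongrightarrow> 0) (at_right 0)"
    by (rule Lim_transform_eventually)
       (auto simp: flat_fun_def eventually_at_filter exp_minus divide_inverse)
  have l: "(flat_fun k \<longlongrightarrow> 0) (at_left 0)"
    by (rule Lim_transform_eventually[OF tendsto_const])
       (auto simp: flat_fun_def eventually_at_filter)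
  show ?thesis using filterlim_split_at[OF l r] .
qed

lemma flat_fun_DERIV:
  "(flat_fun k has_real_derivative flat_fun (k + 2) x - real k * flat_fun (k + 1) x) (at x)"
proof -
  consider "x > 0" | "x < 0" | "x = 0" by linarith
  then show ?thesis
  proof cases
    case 1
    have "((\<lambda>x. inverse x ^ k * exp (- inverse x)) has_real_derivative
        flat_fun (k + 2) x - real k * flat_fun (k + 1) x) (at x)"
    \<comment> \<open>The power rule is applied to an exponent \<open>Suc n\<close>; for k = 0 the
      power is constant and the second term of the claim drops out.\<close>
    proof (cases k)
      case (Suc n)
      have i: "(inverse has_real_derivative - (inverse x * inverse x)) (at x)"
        using 1 DERIV_inverse[of x] by (simp add: power2_eq_square)
      have "((\<lambda>x. exp (- inverse x)) has_real_derivative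
          exp (- inverse x) * (inverse x * inverse x)) (at x)"
        using DERIV_fun_exp[OF DERIV_minus[OF i]] by simp
      from DERIV_mult[OF DERIV_power_Suc[OF i, of n] this]
      have "((\<lambda>x. inverse x ^ Suc n * exp (- inverse x)) has_real_derivative
          (1 + of_nat n) * (- (inverse x * inverse x) * inverse x ^ n) * exp (- inverse x)
          + (exp (- inverse x) * (inverse x * inverse x)) * inverse x ^ Suc n) (at x)" .
      then show ?thesis
        using 1 Suc by (simp add: flat_fun_def algebra_simps)
    qed (use 1 in \<open>auto intro!: derivative_eq_intros simp: flat_fun_def\<close>)
    then show ?thesis
      by (rule has_field_derivative_transform_within_open[where S = "{0<..}"])
         (use 1 in \<open>auto simp: flat_fun_def\<close>)
  next
    case 2
    have "((\<lambda>_. 0) has_real_derivative flat_fun (k + 2) x - real k * flat_fun (k + 1) x) (at x)"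
      using 2 by (auto simp: flat_fun_def)
    then show ?thesis
      by (rule has_field_derivative_transform_within_open[where S = "{..<0}"])
         (use 2 in \<open>auto simp: flat_fun_def\<close>)
  next
    case 3
    \<comment> \<open>The difference quotient at 0 is again a flat function, with k raised by
      one.\<close>
    have "((\<lambda>y. flat_fun k y / y) \<longlongrightarrow> 0) (at 0)"
      by (rule Lim_transform_eventually[OF flat_fun_tendsto[of "Suc k"]])
         (auto simp: flat_fun_def eventually_at_filter field_simps)
    then show ?thesis using 3 by (simp add: has_field_derivative_iff flat_fun_def)
  qed
qed

text \<open>The shape f - c g is exactly the one produced by \<open>flat_fun_DERIV\<close>.\<close>

inductive_set flat_hull :: "(real \<Rightarrow> real) set" where
  base: "flat_fun k \<in> flat_hull"
| lin: "f \<in> flat_hull \<Longrightarrow> g \<in> flat_hull \<Longrightarrow> (\<lambda>x. f x - c * g x) \<in> flat_hull"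

lemma smooth_real_flat_fun: "smooth_real UNIV (flat_fun k)"
proof (rule smooth_real_coinduct[where F = flat_hull])
  fix f assume "f \<in> flat_hull"
  then show "\<exists>f'\<in>flat_hull. \<forall>x\<in>UNIV. (f has_real_derivative f' x) (at x)"
  proof induction
    case (base k)
    have "(\<lambda>x. flat_fun (k + 2) x - real k * flat_fun (k + 1) x) \<in> flat_hull"
      by (intro flat_hull.intros)
    then show ?case using flat_fun_DERIV[of k] by (intro bexI[rotated]) auto
  next
    case (lin f g c)
    then obtain f' g' where *: "f' \<in> flat_hull" "\<forall>x\<in>UNIV. (f has_real_derivative f' x) (at x)"
      "g' \<in> flat_hull" "\<forall>x\<in>UNIV. (g has_real_derivative g' x) (at x)" by blast
    have "\<forall>x\<in>UNIV. ((\<lambda>x. f x - c * g x) has_real_derivative f' x - c * g' x) (at x)"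
      using * by (auto intro!: derivative_eq_intros)
    then show ?case by (intro bexI[where x = "\<lambda>x. f' x - c * g' x"] flat_hull.lin * )
  qed
qed (auto intro: flat_hull.base)

section \<open>Primitives and a smooth step function\<close>

lemma antiderivative_from_left:
  fixes v :: "real \<Rightarrow> real"
  assumes "continuous_on UNIV v" "\<And>t. t \<le> a \<Longrightarrow> v t = 0"
  obtains F where "\<And>t. (F has_real_derivative v t) (at t)" "\<And>t. t \<le> a \<Longrightarrow> F t = 0"
proof
  \<comment> \<open>Starting at a - 1 instead of a costs nothing, as v vanishes there, and makes
    every t \<ge> a an interior point of the interval of integration.\<close>
  define F where "F t = integral {a - 1..t} v" for t
  show z: "F t = 0" if "t \<le> a" for t
    unfolding F_def using that assms(2) by (intro integral_unique has_integral_is_0) auto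
  show "(F has_real_derivative v t) (at t)" for t
  proof (cases "t < a")
    case True
    have "((\<lambda>_. 0) has_real_derivative v t) (at t)" using True assms(2) by simp
    then show ?thesis
      by (rule has_field_derivative_transform_within_open[where S = "{..<a}"]) (use True z in auto)
  next
    case False
    have "(F has_real_derivative v t) (at t within {a - 1..t + 1})"
      unfolding F_def using False
      by (intro integral_has_real_derivative continuous_on_subset[OF assms(1)]) auto
    moreover have "at t within {a - 1..t + 1} = at t"
      using False by (intro at_within_interior) (auto simp: interior_atLeastAtMost_real)
    ultimately show ?thesis by simp
  qed
qed

lemma DERIV_zero_constant_on_interval:
  fixes F :: "real \<Rightarrow> real"
  assumes "\<And>t. a \<le> t \<Longrightarrow> (F has_real_derivative 0) (at t)" "a \<le> s"
  shows "F s = F a"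
proof (cases "a = s")
  case False
  have "continuous_on {a..s} F"
    by (intro continuous_at_imp_continuous_on) (auto intro!: DERIV_isCont assms(1))
  then show ?thesis
    using False assms(2) by (intro DERIV_isconst2[of a s]) (auto intro: assms(1))
qed simp

definition bump :: "real \<Rightarrow> real" where
  "bump x = flat_fun 0 x * flat_fun 0 (1 - x)"

lemma smooth_real_bump: "smooth_real UNIV bump"
proof -
  have "smooth_real UNIV (\<lambda>x. flat_fun 0 x * flat_fun 0 ((-1) * x + 1))"
    by (intro smooth_real_mult smooth_real_flat_fun smooth_real_comp_affine open_UNIV)
  then show ?thesis by (simp add: bump_def[abs_def])
qed

lemma bump_nonneg: "bump x \<ge> 0"
  and bump_pos: "0 < x \<Longrightarrow> x < 1 \<Longrightarrow> bump x > 0"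
  and bump_outside: "x \<le> 0 \<or> 1 \<le> x \<Longrightarrow> bump x = 0"
  by (auto simp: bump_def flat_fun_def)

lemma smooth_real_continuous: "smooth_real UNIV f \<Longrightarrow> continuous_on UNIV f"
  by (intro continuous_at_imp_continuous_on ballI DERIV_isCont[OF smooth_real_DERIV]) auto

text \<open>The normalised primitive of \<open>bump\<close>. Strict positivity of the derivative on
  (0, 1) is what in the end forces u to vanish on a whole shell.\<close>

lemma smooth_step_exists:
  obtains s :: "real \<Rightarrow> real" where "smooth_real UNIV s" "\<And>t. deriv s t \<ge> 0"
    "\<And>t. 0 < t \<Longrightarrow> t < 1 \<Longrightarrow> deriv s t > 0" "\<And>t. t \<le> 0 \<or> 1 \<le> t \<Longrightarrow> deriv s t = 0"
    "\<And>t. t \<le> 0 \<Longrightarrow> s t = 0" "\<And>t. t \<ge> 1 \<Longrightarrow> s t = 1" "\<And>t. s t \<ge> 0" "\<And>t. s t \<le> 1"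
proof -
  obtain F where F: "\<And>t. (F has_real_derivative bump t) (at t)" "\<And>t. t \<le> 0 \<Longrightarrow> F t = 0"
    using antiderivative_from_left[OF smooth_real_continuous[OF smooth_real_bump], of 0] bump_outside
    by auto
  have "F 0 < F 1"
    by (rule DERIV_pos_imp_increasing_open[where f = F])
       (use F bump_pos in \<open>auto intro!: continuous_at_imp_continuous_on DERIV_isCont\<close>)
  then have F1: "F 1 > 0" using F(2)[of 0] by simp
  define s where "s = (\<lambda>t. (1 / F 1) * F t)"
  have smF: "smooth_real UNIV F" by (rule smooth_real_antideriv[OF _ smooth_real_bump]) (use F in auto)
  have D: "(s has_real_derivative bump t / F 1) (at t)" for t
    unfolding s_def using DERIV_cmult[OF F(1), of "1 / F 1" t] by simp
  then have ds: "deriv s t = bump t / F 1" for t by (rule DERIV_imp_deriv)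
  have mono: "s x \<le> s y" if "x \<le> y" for x y
    by (rule DERIV_nonneg_imp_nondecreasing[OF that]) (use D bump_nonneg F1 in force)
  have s1: "s t = 1" if "t \<ge> 1" for t
  proof -
    have "(s has_real_derivative 0) (at y)" if "1 \<le> y" for y
      using D[of y] bump_outside[of y] that by simp
    then have "s t = s 1" by (rule DERIV_zero_constant_on_interval) (use that in auto)
    then show ?thesis using F1 by (simp add: s_def)
  qed
  have s0: "s t = 0" if "t \<le> 0" for t using F(2)[OF that] by (simp add: s_def)
  show ?thesis
  proof
    show "smooth_real UNIV s" unfolding s_def
      by (intro smooth_real_mult smooth_real_const smF open_UNIV)
    show "s t \<ge> 0" for t using mono[of "min t 0" t] s0[of "min t 0"] by simp
    show "s t \<le> 1" for t using mono[of t "max t 1"] s1[of "max t 1"] by simp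
  qed (use ds bump_nonneg bump_pos bump_outside F1 s0 s1 in auto)
qed

section \<open>Test functions built from the height and the radius\<close>

text \<open>The radial variable is \<open>x \<bullet> x\<close>, not the norm, so that no
  singularity arises at the origin. Its partial derivatives produce the factors
  \<open>x \<bullet> b\<close>, hence the rule \<open>linear\<close>; with it the class is closed
  under partial derivatives.\<close>

inductive_set smooth_alg :: "'a::euclidean_space \<Rightarrow> ('a \<Rightarrow> real) set" for \<nu> where
  height: "smooth_real UNIV G \<Longrightarrow> (\<lambda>x. G (\<nu> \<bullet> x)) \<in> smooth_alg \<nu>"
| radial: "smooth_real UNIV H \<Longrightarrow> (\<lambda>x. H (x \<bullet> x)) \<in> smooth_alg \<nu>"
| linear: "(\<lambda>x. x \<bullet> b) \<in> smooth_alg \<nu>"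
| add: "f \<in> smooth_alg \<nu> \<Longrightarrow> g \<in> smooth_alg \<nu> \<Longrightarrow> (\<lambda>x. f x + g x) \<in> smooth_alg \<nu>"
| mult: "f \<in> smooth_alg \<nu> \<Longrightarrow> g \<in> smooth_alg \<nu> \<Longrightarrow> (\<lambda>x. f x * g x) \<in> smooth_alg \<nu>"

lemma smooth_alg_const: "(\<lambda>_. c) \<in> smooth_alg \<nu>"
  by (rule smooth_alg.height[OF smooth_real_const])

lemma has_derivative_height:
  assumes "smooth_real UNIV G"
  shows "((\<lambda>x. G (\<nu> \<bullet> x)) has_derivative (\<lambda>h. deriv G (\<nu> \<bullet> x) * (\<nu> \<bullet> h))) (at x)"
proof -
  have "((\<lambda>x. \<nu> \<bullet> x) has_derivative (\<lambda>h. \<nu> \<bullet> h)) (at x)"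
    by (auto intro!: derivative_eq_intros)
  from has_derivative_compose[OF this
      smooth_real_DERIV[OF assms UNIV_I, unfolded has_field_derivative_def]]
  show ?thesis .
qed

lemma has_derivative_radial:
  assumes "smooth_real UNIV H"
  shows "((\<lambda>x. H (x \<bullet> x)) has_derivative (\<lambda>h. deriv H (x \<bullet> x) * (2 * (x \<bullet> h)))) (at x)"
proof -
  have "((\<lambda>x. x \<bullet> x) has_derivative (\<lambda>h. 2 * (x \<bullet> h))) (at x)"
    by (auto intro!: derivative_eq_intros simp: inner_commute)
  from has_derivative_compose[OF this
      smooth_real_DERIV[OF assms UNIV_I, unfolded has_field_derivative_def]]
  show ?thesis .
qed

lemma smooth_alg_has_derivative:
  assumes "f \<in> smooth_alg \<nu>"
  shows "\<exists>D. (\<forall>x. (f has_derivative D x) (at x)) \<and> (\<forall>b. (\<lambda>x. D x b) \<in> smooth_alg \<nu>)"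
  using assms
proof induction
  case (height G)
  have "(\<lambda>x. deriv G (\<nu> \<bullet> x) * (\<nu> \<bullet> b)) \<in> smooth_alg \<nu>" for b
    by (intro smooth_alg.mult smooth_alg_const smooth_alg.height[OF smooth_real_deriv] height)
  with has_derivative_height[OF height, of \<nu>] show ?case
    by (intro exI[where x = "\<lambda>x h. deriv G (\<nu> \<bullet> x) * (\<nu> \<bullet> h)"]) simp
next
  case (radial H)
  have "(\<lambda>x. deriv H (x \<bullet> x) * (2 * (x \<bullet> b))) \<in> smooth_alg \<nu>" for b
    by (intro smooth_alg.mult smooth_alg_const smooth_alg.radial[OF smooth_real_deriv]
        smooth_alg.linear radial)
  then show ?case
    by (intro exI[where x = "\<lambda>x h. deriv H (x \<bullet> x) * (2 * (x \<bullet> h))"])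
       (simp add: has_derivative_radial[OF radial])
next
  case (linear b)
  have "((\<lambda>x. x \<bullet> b) has_derivative (\<lambda>h. h \<bullet> b)) (at x)" for x
    by (auto intro!: derivative_eq_intros)
  then show ?case
    by (intro exI[where x = "\<lambda>x h. h \<bullet> b"]) (auto intro: smooth_alg_const)
next
  case (add f g)
  then obtain D E where DE: "\<forall>x. (f has_derivative D x) (at x)" "\<forall>b. (\<lambda>x. D x b) \<in> smooth_alg \<nu>"
    "\<forall>x. (g has_derivative E x) (at x)" "\<forall>b. (\<lambda>x. E x b) \<in> smooth_alg \<nu>" by blast
  show ?case
    by (intro exI[where x = "\<lambda>x h. D x h + E x h"])
       (use DE in \<open>auto intro!: has_derivative_add smooth_alg.add\<close>)
next
  case (mult f g)
  then obtain D E where DE: "\<forall>x. (f has_derivative D x) (at x)" "\<forall>b. (\<lambda>x. D x b) \<in> smooth_alg \<nu>"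
    "\<forall>x. (g has_derivative E x) (at x)" "\<forall>b. (\<lambda>x. E x b) \<in> smooth_alg \<nu>" by blast
  show ?case
    by (intro exI[where x = "\<lambda>x h. f x * E x h + D x h * g x"])
       (use DE mult.hyps in \<open>auto intro!: has_derivative_mult smooth_alg.add smooth_alg.mult\<close>)
qed

lemma partial_deriv_eq:
  "(\<And>x. (f has_derivative D x) (at x)) \<Longrightarrow> partial_deriv b f = (\<lambda>x. D x b)"
  unfolding partial_deriv_def by (metis frechet_derivative_at)

lemma smooth_alg_C_k: "f \<in> smooth_alg \<nu> \<Longrightarrow> C_k k f"
proof (induction k arbitrary: f)
  case 0
  obtain D where D: "\<And>x. (f has_derivative D x) (at x)"
    using smooth_alg_has_derivative[OF 0] by blast
  show ?case
    by (simp add: continuous_at_imp_continuous_on has_derivative_continuous[OF D])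
next
  case (Suc k)
  obtain D where D: "\<And>x. (f has_derivative D x) (at x)" "\<And>b. (\<lambda>x. D x b) \<in> smooth_alg \<nu>"
    using smooth_alg_has_derivative[OF Suc.prems] by blast
  show ?case
    using Suc.IH[OF D(2)] D(1) by (auto simp: partial_deriv_eq[OF D(1)] differentiable_def)
qed

text \<open>The product rule for the Laplacian. The middle term is twice the inner product of the
  gradients G' \<nu> and 2 H' x; it is later merged with the first-order term of the last
  line.\<close>

lemma laplacian_height_radial:
  fixes \<nu> :: "'a::euclidean_space"
  assumes G: "smooth_real UNIV G" and H: "smooth_real UNIV H"
  shows "laplacian (\<lambda>x. G (\<nu> \<bullet> x) * H (x \<bullet> x)) x =
    (\<nu> \<bullet> \<nu>) * deriv (deriv G) (\<nu> \<bullet> x) * H (x \<bullet> x)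
    + 4 * (\<nu> \<bullet> x) * deriv G (\<nu> \<bullet> x) * deriv H (x \<bullet> x)
    + G (\<nu> \<bullet> x) * (4 * (x \<bullet> x) * deriv (deriv H) (x \<bullet> x) + 2 * real DIM('a) * deriv H (x \<bullet> x))"
proof -
  note dG = has_derivative_height[OF G] has_derivative_height[OF smooth_real_deriv[OF G]]
  note dH = has_derivative_radial[OF H] has_derivative_radial[OF smooth_real_deriv[OF H]]
  have 1: "partial_deriv b (\<lambda>x. G (\<nu> \<bullet> x) * H (x \<bullet> x)) =
     (\<lambda>x. G (\<nu> \<bullet> x) * (deriv H (x \<bullet> x) * (2 * (x \<bullet> b)))
        + deriv G (\<nu> \<bullet> x) * (\<nu> \<bullet> b) * H (x \<bullet> x))" for b
    by (rule partial_deriv_eq[OF has_derivative_mult[OF dG(1) dH(1)]])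
  have lin: "((\<lambda>x. 2 * (x \<bullet> b)) has_derivative (\<lambda>h. 2 * (h \<bullet> b))) (at x)" for x b :: 'a
    by (auto intro!: derivative_eq_intros)
  have con: "((\<lambda>x. \<nu> \<bullet> b) has_derivative (\<lambda>h. 0)) (at x)" for x b :: 'a by simp
  have 2: "partial_deriv b (partial_deriv b (\<lambda>x. G (\<nu> \<bullet> x) * H (x \<bullet> x))) x =
      deriv (deriv G) (\<nu> \<bullet> x) * H (x \<bullet> x) * ((\<nu> \<bullet> b) * (\<nu> \<bullet> b))
      + 4 * deriv G (\<nu> \<bullet> x) * deriv H (x \<bullet> x) * ((\<nu> \<bullet> b) * (x \<bullet> b))
      + 4 * G (\<nu> \<bullet> x) * deriv (deriv H) (x \<bullet> x) * ((x \<bullet> b) * (x \<bullet> b))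
      + 2 * G (\<nu> \<bullet> x) * deriv H (x \<bullet> x)" if "b \<in> Basis" for b
    unfolding 1
    unfolding partial_deriv_eq[OF has_derivative_add[OF
      has_derivative_mult[OF dG(1) has_derivative_mult[OF dH(2) lin]]
      has_derivative_mult[OF has_derivative_mult[OF dG(2) con] dH(1)]]]
    using that by (simp add: algebra_simps)
  have "laplacian (\<lambda>x. G (\<nu> \<bullet> x) * H (x \<bullet> x)) x =
      deriv (deriv G) (\<nu> \<bullet> x) * H (x \<bullet> x) * (\<nu> \<bullet> \<nu>)
      + 4 * deriv G (\<nu> \<bullet> x) * deriv H (x \<bullet> x) * (\<nu> \<bullet> x)
      + 4 * G (\<nu> \<bullet> x) * deriv (deriv H) (x \<bullet> x) * (x \<bullet> x)
      + 2 * G (\<nu> \<bullet> x) * deriv H (x \<bullet> x) * real DIM('a)"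
    unfolding laplacian_def
    by (subst (1 2 3) euclidean_inner) (simp add: 2 sum.distrib sum_distrib_left)
  then show ?thesis by (simp add: algebra_simps)
qed

text \<open>The height factor keeps the support off the flat boundary, and with it off the origin;
  the radial factor keeps it off the sphere.\<close>

lemma test_function_height_radial:
  fixes \<nu> :: "'a::euclidean_space"
  assumes G: "smooth_real UNIV G" and H: "smooth_real UNIV H"
    and G0: "\<And>z. z \<le> \<epsilon> \<Longrightarrow> G z = 0" and "0 < \<epsilon>"
    and H0: "\<And>s. r\<^sup>2 < s \<Longrightarrow> H s = 0" and r: "0 \<le> r" "r < R"
  shows "test_function_on (half_ball \<nu> R) (\<lambda>x. G (\<nu> \<bullet> x) * H (x \<bullet> x))"
proof -
  let ?\<phi> = "\<lambda>x. G (\<nu> \<bullet> x) * H (x \<bullet> x)"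
  define K where "K = cball 0 r \<inter> {x. \<nu> \<bullet> x \<ge> \<epsilon>}"
  have cK: "compact K" unfolding K_def
    by (intro compact_Int_closed compact_cball closed_halfspace_ge)
  have "{x. ?\<phi> x \<noteq> 0} \<subseteq> K"
  proof
    fix x assume "x \<in> {x. ?\<phi> x \<noteq> 0}"
    then have "\<not> \<nu> \<bullet> x \<le> \<epsilon>" "\<not> r\<^sup>2 < x \<bullet> x" using G0 H0 by auto
    then show "x \<in> K"
      using power2_le_imp_le[OF _ r(1), of "norm x"] by (simp add: K_def dot_square_norm not_less)
  qed
  then have sub: "closure {x. ?\<phi> x \<noteq> 0} \<subseteq> K"
    using closure_minimal compact_imp_closed[OF cK] by blast
  have "K \<subseteq> half_ball \<nu> R" using \<open>0 < \<epsilon>\<close> r by (auto simp: K_def half_ball_def)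
  with sub have "closure {x. ?\<phi> x \<noteq> 0} \<subseteq> half_ball \<nu> R" by blast
  moreover have "compact (closure {x. ?\<phi> x \<noteq> 0})"
    using compact_Int_closed[OF cK closed_closure, of "{x. ?\<phi> x \<noteq> 0}"] sub by (simp add: Int_absorb1)
  moreover have "C_k k ?\<phi>" for k
    by (rule smooth_alg_C_k[of _ \<nu>]) (intro smooth_alg.intros G H)
  ultimately show ?thesis unfolding test_function_on_def by blast
qed

section \<open>Compactly supported subsolutions of the radial equation\<close>

lemma deriv_deriv_eqI:
  fixes f f1 f2 :: "real \<Rightarrow> real"
  assumes "open S" "\<And>t. t \<in> S \<Longrightarrow> (f has_real_derivative f1 t) (at t)"
    "\<And>t. t \<in> S \<Longrightarrow> (f1 has_real_derivative f2 t) (at t)" "t \<in> S"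
  shows "deriv (deriv f) t = f2 t"
proof -
  have "(deriv f has_real_derivative f2 t) (at t)"
    by (rule has_field_derivative_transform_within_open[OF assms(3)[OF assms(4)] assms(1,4)])
       (simp add: DERIV_imp_deriv[OF assms(2)])
  then show ?thesis by (rule DERIV_imp_deriv)
qed

lemma deriv_eq_0_outside:
  fixes f :: "real \<Rightarrow> real"
  assumes "\<And>t. t < a \<or> b < t \<Longrightarrow> f t = 0" "t < a \<or> b < t"
  shows "deriv f t = 0"
proof -
  have "((\<lambda>_. 0) has_real_derivative 0) (at t)" by simp
  then have "(f has_real_derivative 0) (at t)"
    by (rule has_field_derivative_transform_within_open[where S = "{..<a} \<union> {b<..}"])
       (use assms in auto)
  then show ?thesis by (rule DERIV_imp_deriv)
qed

lemma bounded_if_zero_outside: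
  fixes f :: "real \<Rightarrow> real"
  assumes "continuous_on UNIV f" "\<And>t. t < a \<or> b < t \<Longrightarrow> f t = 0"
  obtains B where "B \<ge> 0" "\<And>t. \<bar>f t\<bar> \<le> B"
proof -
  have "bounded (f ` {a..b})"
    by (intro compact_imp_bounded compact_continuous_image continuous_on_subset[OF assms(1)]) auto
  then obtain B where B: "B > 0" "\<And>t. t \<in> {a..b} \<Longrightarrow> \<bar>f t\<bar> \<le> B"
    unfolding bounded_pos by auto
  show ?thesis
  proof (rule that)
    show "B \<ge> 0" using B by simp
    show "\<bar>f t\<bar> \<le> B" for t
      using B(2)[of t] assms(2)[of t] B(1) by (cases "t \<in> {a..b}") auto
  qed
qed

text \<open>The function q before its cut-off. \<open>W\<close> is a step up on [a, a+1] minus a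
  stretched step on [K, 2K]; K \<ge> a + 1 lets the rise finish before the fall starts, so
  \<open>W\<close>, and hence q', is nonnegative.\<close>

lemma subsolution_with_growth:
  fixes s :: "real \<Rightarrow> real"
  assumes s: "smooth_real UNIV s"
    "\<And>t. t \<le> 0 \<Longrightarrow> s t = 0" "\<And>t. t \<ge> 1 \<Longrightarrow> s t = 1" "\<And>t. s t \<ge> 0" "\<And>t. s t \<le> 1"
    and \<beta>: "\<beta> \<ge> 0" and a: "a > 0" and K: "K \<ge> a + 1"
  obtains W q where "smooth_real UNIV q" "\<And>t. t \<le> a \<Longrightarrow> q t = 0" "\<And>t. q t \<ge> 0"
    "\<And>t. 2 * K \<le> t \<Longrightarrow> q t = q (2 * K)"
    "\<And>t. 2 * K \<le> t \<Longrightarrow> W t = 0"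
    "\<And>t. (q has_real_derivative t powr (-1 - 2 * \<beta>) * W t) (at t)"
    "\<And>t. (W has_real_derivative deriv s (t - a) - deriv s (t / K - 1) / K) (at t)"
proof -
  define W where "W t = s (t - a) - s (t / K - 1)" for t
  have W0: "W t = 0" if "t \<le> a" for t
  proof -
    have "t / K - 1 \<le> 0" using that K a by (simp add: field_simps)
    then show ?thesis using that by (simp add: W_def s(2))
  qed
  have W1: "W t = 0" if "2 * K \<le> t" for t
  proof -
    have "t / K - 1 \<ge> 1" using that K a by (simp add: field_simps)
    moreover have "t - a \<ge> 1" using that K a by simp
    ultimately show ?thesis by (simp add: W_def s(3))
  qed
  have Wnn: "W t \<ge> 0" for t
  proof (cases "t \<le> K")
    case True
    then have "t / K - 1 \<le> 0" using K a by (simp add: field_simps)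
    then show ?thesis by (simp add: W_def s(2,4))
  next
    case False
    then show ?thesis using K s(3)[of "t - a"] s(5)[of "t / K - 1"] by (simp add: W_def)
  qed
  have Weq: "W = (\<lambda>t. s (1 * t + (- a)) + (- 1) * s ((1 / K) * t + (- 1)))"
    by (auto simp: W_def)
  have smW: "smooth_real UNIV W" unfolding Weq
    by (intro smooth_real_add smooth_real_mult smooth_real_const smooth_real_comp_affine s open_UNIV)
  have DW: "(W has_real_derivative deriv s (t - a) - deriv s (t / K - 1) / K) (at t)" for t
  proof -
    have "((\<lambda>t. s (t - a)) has_real_derivative deriv s (t - a) * 1) (at t)"
      by (rule DERIV_chain2[OF smooth_real_DERIV[OF s(1) UNIV_I]]) (auto intro!: derivative_eq_intros)
    moreover have "((\<lambda>t. s (t / K - 1)) has_real_derivative deriv s (t / K - 1) * (1 / K)) (at t)"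
      by (rule DERIV_chain2[OF smooth_real_DERIV[OF s(1) UNIV_I]])
         (use K a in \<open>auto intro!: derivative_eq_intros\<close>)
    ultimately show ?thesis unfolding W_def[abs_def] using DERIV_diff by fastforce
  qed
  define v where "v t = t powr (-1 - 2 * \<beta>) * W t" for t
  \<comment> \<open>The power is smooth only for t > 0, but \<open>W\<close> vanishes up to a > 0.
    The two open half-lines overlap and cover the line.\<close>
  have "smooth_real {0<..} v" unfolding v_def[abs_def]
    by (intro smooth_real_mult smooth_real_powr smooth_real_subset[OF smW]) auto
  moreover have "smooth_real {..<a} v"
    by (rule smooth_real_cong[OF _ smooth_real_subset[OF smooth_real_const[of 0]]])
       (auto simp: v_def W0)
  ultimately have "smooth_real ({0<..} \<union> {..<a}) v" by (rule smooth_real_Un)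
  moreover have "{0<..} \<union> {..<a} = UNIV" using a by auto
  ultimately have smv: "smooth_real UNIV v" by simp
  obtain q where q: "\<And>t. (q has_real_derivative v t) (at t)" "\<And>t. t \<le> a \<Longrightarrow> q t = 0"
    using antiderivative_from_left[OF smooth_real_continuous[OF smv], of a] W0 by (auto simp: v_def)
  show ?thesis
  proof (rule that[of q W])
    show "smooth_real UNIV q" by (rule smooth_real_antideriv[OF _ smv]) (use q in auto)
    show "q t \<ge> 0" for t
    proof -
      have "q (min t a) \<le> q t"
        by (rule DERIV_nonneg_imp_nondecreasing) (use q(1) Wnn in \<open>force simp: v_def\<close>)+
      then show ?thesis using q(2)[of "min t a"] by simp
    qed
    show "q t = q (2 * K)" if "2 * K \<le> t" for t
    proof (rule DERIV_zero_constant_on_interval[OF _ that])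
      show "(q has_real_derivative 0) (at t)" if "2 * K \<le> t" for t
        using q(1)[of t] W1[OF that] by (simp add: v_def)
    qed
    show "(q has_real_derivative t powr (-1 - 2 * \<beta>) * W t) (at t)" for t
      using q(1)[of t] by (simp add: v_def)
  qed (use q W1 DW in auto)
qed

text \<open>Only $C'$ may depend on $K$: for $\beta = 0$ the plateau value of $q$ grows like $\log K$, which
  is why $L$ has to be sent to infinity before $K$.\<close>

lemma truncated_subsolution:
  fixes s :: "real \<Rightarrow> real"
  assumes s: "smooth_real UNIV s" "\<And>t. deriv s t \<ge> 0" "\<And>t. t \<le> 0 \<or> 1 \<le> t \<Longrightarrow> deriv s t = 0"
    "\<And>t. t \<le> 0 \<Longrightarrow> s t = 0" "\<And>t. t \<ge> 1 \<Longrightarrow> s t = 1" "\<And>t. s t \<ge> 0" "\<And>t. s t \<le> 1"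
    and B: "\<And>t. deriv s t \<le> B" "\<And>t. \<bar>deriv (deriv s) t\<bar> \<le> B"
    and \<beta>: "\<beta> \<ge> 0" and a: "a > 0" and K: "K \<ge> a + 1"
  shows "\<exists>C'\<ge>0. \<forall>L\<ge>2 * K. \<exists>\<psi>. smooth_real UNIV \<psi> \<and> (\<forall>t. \<psi> t \<ge> 0) \<and>
    (\<forall>t. t \<le> a \<or> 2 * L \<le> t \<longrightarrow> \<psi> t = 0) \<and>
    (\<forall>t>0. deriv (deriv \<psi>) t + (1/4 - \<beta>\<^sup>2) / t\<^sup>2 * \<psi> t \<ge>
      t powr (-1/2 - \<beta>) * deriv s (t - a) - B * K powr (-3/2 - \<beta>) * indicator {K..2 * K} t
      - C' * L powr (\<beta> - 3/2) * indicator {L..2 * L} t)"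
proof -
  obtain W q where q: "smooth_real UNIV q" "\<And>t. t \<le> a \<Longrightarrow> q t = 0" "\<And>t. q t \<ge> 0"
    "\<And>t. 2 * K \<le> t \<Longrightarrow> q t = q (2 * K)"
    and W: "\<And>t. 2 * K \<le> t \<Longrightarrow> W t = 0"
    and Dq: "\<And>t. (q has_real_derivative t powr (-1 - 2 * \<beta>) * W t) (at t)"
    and DW: "\<And>t. (W has_real_derivative deriv s (t - a) - deriv s (t / K - 1) / K) (at t)"
    using subsolution_with_growth[OF s(1,4-7) \<beta> a K] by metis
  \<comment> \<open>The growing exponent: p (p - 1) = \<beta>^2 - 1/4, so t^p solves the homogeneous
    equation.\<close>
  define p where "p = 1/2 + \<beta>"
  define Q where "Q = q (2 * K)"
  \<comment> \<open>On [L, 2L], where q = Q, the derivatives of the cut-off are at most B/L and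
    B/L^2. Bounding t^p by (2L)^p there gives an error Q B (1 + 2p) 2^p L^(p-2), and p - 2 = \<beta>
    - 3/2.\<close>
  define C' where "C' = Q * B * (1 + 2 * p) * 2 powr p"
  have B0: "B \<ge> 0" using B(1)[of 0] s(2)[of 0] by linarith
  have p: "p > 0" using \<beta> by (simp add: p_def)
  have Q0: "Q \<ge> 0" using q(3) by (simp add: Q_def)
  have C0: "C' \<ge> 0" using Q0 B0 p by (simp add: C'_def)
  have "\<exists>\<psi>. smooth_real UNIV \<psi> \<and> (\<forall>t. \<psi> t \<ge> 0) \<and>
    (\<forall>t. t \<le> a \<or> 2 * L \<le> t \<longrightarrow> \<psi> t = 0) \<and>
    (\<forall>t>0. deriv (deriv \<psi>) t + (1/4 - \<beta>\<^sup>2) / t\<^sup>2 * \<psi> t \<ge>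
      t powr (-1/2 - \<beta>) * deriv s (t - a) - B * K powr (-3/2 - \<beta>) * indicator {K..2 * K} t
      - C' * L powr (\<beta> - 3/2) * indicator {L..2 * L} t)" if L: "L \<ge> 2 * K" for L
  proof -
    have L0: "L > 0" and K0: "K > 0" using K a L by auto
    define \<eta> where "\<eta> t = 1 - s (t / L - 1)" for t
    define \<eta>1 where "\<eta>1 t = - deriv s (t / L - 1) / L" for t
    define \<eta>2 where "\<eta>2 t = - deriv (deriv s) (t / L - 1) / L\<^sup>2" for t
    have D\<eta>: "(\<eta> has_real_derivative \<eta>1 t) (at t)" for t
    proof -
      have "((\<lambda>t. s (t / L - 1)) has_real_derivative deriv s (t / L - 1) * (1 / L)) (at t)"
        by (rule DERIV_chain2[OF smooth_real_DERIV[OF s(1) UNIV_I]])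
           (use L0 in \<open>auto intro!: derivative_eq_intros\<close>)
      from DERIV_diff[OF DERIV_const this, of 1] show ?thesis
        by (simp add: \<eta>_def[abs_def] \<eta>1_def)
    qed
    have D\<eta>1: "(\<eta>1 has_real_derivative \<eta>2 t) (at t)" for t
    proof -
      have "((\<lambda>t. deriv s (t / L - 1)) has_real_derivative deriv (deriv s) (t / L - 1) * (1 / L)) (at t)"
        by (rule DERIV_chain2[OF smooth_real_DERIV[OF smooth_real_deriv[OF s(1)] UNIV_I]])
           (use L0 in \<open>auto intro!: derivative_eq_intros\<close>)
      from DERIV_cmult[OF this, of "-1 / L"] show ?thesis
        by (simp add: \<eta>1_def[abs_def] \<eta>2_def power2_eq_square)
    qed
    have \<eta>eq: "\<eta> = (\<lambda>t. 1 + (- 1) * s ((1 / L) * t + (- 1)))" by (auto simp: \<eta>_def)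
    have sm\<eta>: "smooth_real UNIV \<eta>" unfolding \<eta>eq
      by (intro smooth_real_add smooth_real_mult smooth_real_const smooth_real_comp_affine s open_UNIV)
    have sm: "smooth_real UNIV (\<lambda>t. q t * \<eta> t)" by (intro smooth_real_mult q sm\<eta> open_UNIV)
    define \<psi> where "\<psi> t = t powr p * (q t * \<eta> t)" for t
    have "smooth_real {0<..} \<psi>" unfolding \<psi>_def[abs_def]
      by (intro smooth_real_mult[OF _ smooth_real_powr] smooth_real_subset[OF sm]) auto
    moreover have "smooth_real {..<a} \<psi>"
      by (rule smooth_real_cong[OF _ smooth_real_subset[OF smooth_real_const[of 0]]])
         (auto simp: \<psi>_def q(2))
    ultimately have "smooth_real ({0<..} \<union> {..<a}) \<psi>" by (rule smooth_real_Un)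
    moreover have "{0<..} \<union> {..<a} = UNIV" using a by auto
    ultimately have sm\<psi>: "smooth_real UNIV \<psi>" by simp
    have \<psi>0: "\<psi> t = 0" if "t \<le> a \<or> 2 * L \<le> t" for t
    proof (cases "t \<le> a")
      case False
      then have "t / L - 1 \<ge> 1" using that L0 by (simp add: field_simps)
      then show ?thesis by (simp add: \<psi>_def \<eta>_def s(5))
    qed (simp add: \<psi>_def q(2))
    have \<psi>nn: "\<psi> t \<ge> 0" for t using q(3) s(7) by (simp add: \<psi>_def \<eta>_def)
    define q1 where "q1 t = t powr (-1 - 2 * \<beta>) * W t" for t
    define W1 where "W1 t = deriv s (t - a) - deriv s (t / K - 1) / K" for t
    define q2 where "q2 t = (-1 - 2 * \<beta>) * t powr (-2 - 2 * \<beta>) * W t + t powr (-1 - 2 * \<beta>) * W1 t" for t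
    have Dq1: "(q1 has_real_derivative q2 t) (at t)" if "t > 0" for t
    proof -
      have "((\<lambda>t. t powr (-1 - 2 * \<beta>)) has_real_derivative (-1 - 2 * \<beta>) * t powr (-2 - 2 * \<beta>)) (at t)"
        using that by (auto intro!: derivative_eq_intros)
      from DERIV_mult[OF this DW[of t]] show ?thesis
        unfolding q1_def[abs_def] q2_def W1_def by (simp add: algebra_simps)
    qed
    define \<psi>1 where "\<psi>1 t = p * t powr (p - 1) * (q t * \<eta> t) + t powr p * (q1 t * \<eta> t + q t * \<eta>1 t)" for t
    define \<psi>2 where "\<psi>2 t = p * (p - 1) * t powr (p - 2) * (q t * \<eta> t)
        + 2 * p * t powr (p - 1) * (q1 t * \<eta> t + q t * \<eta>1 t)
        + t powr p * (q2 t * \<eta> t + 2 * q1 t * \<eta>1 t + q t * \<eta>2 t)" for t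
    have Dp: "((\<lambda>t. t powr r) has_real_derivative r * t powr (r - 1)) (at t)" if "t > 0" for t r
      using that by (auto intro!: derivative_eq_intros)
    have Dq': "(q has_real_derivative q1 t) (at t)" for t using Dq by (simp add: q1_def)
    have D1: "(\<psi> has_real_derivative \<psi>1 t) (at t)" if "t > 0" for t
      unfolding \<psi>_def[abs_def] \<psi>1_def
      by (rule DERIV_cong[OF DERIV_mult[OF Dp[OF that] DERIV_mult[OF Dq' D\<eta>]]]) (simp add: algebra_simps)
    have D2: "(\<psi>1 has_real_derivative \<psi>2 t) (at t)" if "t > 0" for t
      unfolding \<psi>1_def[abs_def] \<psi>2_def
      by (rule DERIV_cong[OF DERIV_add[OF DERIV_mult[OF DERIV_cmult[OF Dp[OF that]] DERIV_mult[OF Dq' D\<eta>]]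
           DERIV_mult[OF Dp[OF that] DERIV_add[OF DERIV_mult[OF Dq1[OF that] D\<eta>] DERIV_mult[OF Dq' D\<eta>1]]]]])
         (simp add: algebra_simps)
    have dd: "deriv (deriv \<psi>) t = \<psi>2 t" if "t > 0" for t
      using deriv_deriv_eqI[of "{0<..}" \<psi> \<psi>1 \<psi>2 t] D1 D2 that by auto
    have "\<psi>2 t + (1/4 - \<beta>\<^sup>2) / t\<^sup>2 * \<psi> t \<ge>
      t powr (-1/2 - \<beta>) * deriv s (t - a) - B * K powr (-3/2 - \<beta>) * indicator {K..2 * K} t
      - C' * L powr (\<beta> - 3/2) * indicator {L..2 * L} t" if t: "t > 0" for t
    proof -
      have e1: "(1/4 - \<beta>\<^sup>2) / t\<^sup>2 * \<psi> t = - (p * (p - 1) * t powr (p - 2) * (q t * \<eta> t))"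
      proof -
        have "t powr (p - 2) = t powr p / t\<^sup>2" using t by (simp add: powr_diff)
        moreover have "1/4 - \<beta>\<^sup>2 = - (p * (p - 1))" by (simp add: p_def power2_eq_square algebra_simps)
        ultimately show ?thesis by (simp add: \<psi>_def)
      qed
      \<comment> \<open>The supports are separated: q' vanishes from 2K on, while the cut-off is
        constant up to L \<ge> 2K.\<close>
      have z1: "q1 t * \<eta>1 t = 0"
      proof (cases "2 * K \<le> t")
        case True
        then show ?thesis by (simp add: q1_def W)
      next
        case False
        then have "t / L - 1 \<le> 0" using L L0 by (simp add: field_simps)
        then show ?thesis by (simp add: \<eta>1_def s(3))
      qed
      \<comment> \<open>This is the factorisation t^(-1/2-\<beta>) (t^(1+2\<beta>) q')'; the terms
        in \<open>W\<close> itself cancel because 2p = 1 + 2 \<beta>.\<close>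
      have e2: "t powr p * q2 t + 2 * p * t powr (p - 1) * q1 t = t powr (-1/2 - \<beta>) * W1 t"
      proof -
        have i: "t powr p * t powr (-1 - 2 * \<beta>) = t powr (-1/2 - \<beta>)"
          "t powr p * t powr (-2 - 2 * \<beta>) = t powr (-3/2 - \<beta>)"
          "t powr (p - 1) * t powr (-1 - 2 * \<beta>) = t powr (-3/2 - \<beta>)"
          unfolding powr_add[symmetric] by (simp_all add: p_def)
        have "t powr p * q2 t + 2 * p * t powr (p - 1) * q1 t =
          (-1 - 2 * \<beta>) * (t powr p * t powr (-2 - 2 * \<beta>)) * W t
          + (t powr p * t powr (-1 - 2 * \<beta>)) * W1 t
          + 2 * p * (t powr (p - 1) * t powr (-1 - 2 * \<beta>)) * W t"
          by (simp add: q1_def q2_def algebra_simps)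
        also have "\<dots> = t powr (-1/2 - \<beta>) * W1 t"
          unfolding i by (simp add: p_def algebra_simps)
        finally show ?thesis .
      qed
      \<comment> \<open>Wherever the derivative of \<open>W\<close> is nonzero, the cut-off still
        equals 1.\<close>
      have z2: "W1 t * \<eta> t = W1 t"
      proof (cases "2 * K \<le> t")
        case True
        then have "t / K - 1 \<ge> 1" "t - a \<ge> 1" using K K0 by (auto simp: field_simps)
        then show ?thesis by (simp add: W1_def s(3))
      next
        case False
        then have "t / L - 1 \<le> 0" using L L0 by (simp add: field_simps)
        then show ?thesis by (simp add: \<eta>_def s(4))
      qed
      have "\<psi>2 t + (1/4 - \<beta>\<^sup>2) / t\<^sup>2 * \<psi> t =
        (t powr p * q2 t + 2 * p * t powr (p - 1) * q1 t) * \<eta> t + 2 * t powr p * (q1 t * \<eta>1 t)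
        + q t * (t powr p * \<eta>2 t + 2 * p * t powr (p - 1) * \<eta>1 t)"
        unfolding e1 \<psi>2_def by (simp add: algebra_simps)
      also have "\<dots> = t powr (-1/2 - \<beta>) * W1 t
        + q t * (t powr p * \<eta>2 t + 2 * p * t powr (p - 1) * \<eta>1 t)"
        unfolding z1 e2 using z2 by (simp add: mult.assoc)
      finally have main: "\<psi>2 t + (1/4 - \<beta>\<^sup>2) / t\<^sup>2 * \<psi> t = t powr (-1/2 - \<beta>) * W1 t
        + q t * (t powr p * \<eta>2 t + 2 * p * t powr (p - 1) * \<eta>1 t)" .
      \<comment> \<open>The price of the descent of \<open>W\<close>: slope at most B/K, times a
        decreasing power that is largest at t = K.\<close>
      have b1: "t powr (-1/2 - \<beta>) * W1 t \<ge> t powr (-1/2 - \<beta>) * deriv s (t - a)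
          - B * K powr (-3/2 - \<beta>) * indicator {K..2 * K} t"
      proof (cases "t \<in> {K..2 * K}")
        case True
        have "t powr (-1/2 - \<beta>) * (deriv s (t / K - 1) / K) \<le> K powr (-1/2 - \<beta>) * (B / K)"
          using True K0 \<beta> B0 s(2) B(1)
          by (intro mult_mono powr_mono2' divide_right_mono) auto
        also have "\<dots> = B * K powr (-3/2 - \<beta>)"
        proof -
          have "K powr (-3/2 - \<beta>) = K powr (-1/2 - \<beta> - 1)" by (rule arg_cong[where f = "\<lambda>r. K powr r"]) simp
          also have "\<dots> = K powr (-1/2 - \<beta>) / K" using K0 by (subst powr_diff) simp
          finally show ?thesis by simp
        qed
        finally show ?thesis using True by (simp add: W1_def algebra_simps)
      next
        case False
        then have "t / K - 1 \<le> 0 \<or> 1 \<le> t / K - 1" using K0 by (auto simp: field_simps)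
        then have "deriv s (t / K - 1) = 0" by (rule s(3))
        then show ?thesis using False by (simp add: W1_def)
      qed
      have b2: "q t * (t powr p * \<eta>2 t + 2 * p * t powr (p - 1) * \<eta>1 t)
          \<ge> - (C' * L powr (\<beta> - 3/2) * indicator {L..2 * L} t)"
      proof (cases "t \<in> {L..2 * L}")
        case True
        have qQ: "q t = Q" unfolding Q_def by (rule q(4)) (use True L in auto)
        have tp: "t powr p \<le> (2 * L) powr p" using True L0 p by (intro powr_mono2) auto
        \<comment> \<open>The exponent p - 1 is negative for \<beta> < 1/2, so monotonicity of
          powers is applied to t^p alone and 1/t is bounded separately.\<close>
        have "t powr (p - 1) = t powr p / t" using t by (simp add: powr_diff)
        also have "\<dots> \<le> (2 * L) powr p / L" using True L0 tp by (intro frac_le) auto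
        finally have tp1: "t powr (p - 1) \<le> (2 * L) powr p / L" .
        have c2: "\<bar>\<eta>2 t\<bar> \<le> B / L\<^sup>2" using B(2) L0 by (simp add: \<eta>2_def divide_right_mono)
        have c1: "\<bar>\<eta>1 t\<bar> \<le> B / L" using B(1) s(2) L0 by (simp add: \<eta>1_def divide_right_mono)
        have "\<bar>t powr p * \<eta>2 t\<bar> \<le> (2 * L) powr p * (B / L\<^sup>2)"
          unfolding abs_mult using tp c2 by (intro mult_mono) auto
        moreover have "\<bar>t powr (p - 1) * \<eta>1 t\<bar> \<le> (2 * L) powr p / L * (B / L)"
          unfolding abs_mult using tp1 c1 L0 by (intro mult_mono) auto
        then have "2 * p * \<bar>t powr (p - 1) * \<eta>1 t\<bar> \<le> 2 * p * ((2 * L) powr p / L * (B / L))"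
          using p by (intro mult_left_mono) auto
        moreover have "2 * p * (t powr (p - 1) * \<eta>1 t) \<ge> - (2 * p * \<bar>t powr (p - 1) * \<eta>1 t\<bar>)"
        proof -
          have "2 * p * (t powr (p - 1) * \<eta>1 t) \<ge> 2 * p * (- \<bar>t powr (p - 1) * \<eta>1 t\<bar>)"
            using p by (intro mult_left_mono) (simp_all add: abs_ge_minus_self minus_le_iff)
          then show ?thesis by (simp only: mult_minus_right)
        qed
        ultimately have "t powr p * \<eta>2 t + 2 * p * t powr (p - 1) * \<eta>1 t \<ge>
            - ((2 * L) powr p * (B / L\<^sup>2) + 2 * p * ((2 * L) powr p / L * (B / L)))"
          unfolding mult.assoc by linarith
        also have "(2 * L) powr p * (B / L\<^sup>2) + 2 * p * ((2 * L) powr p / L * (B / L))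
          = B * (1 + 2 * p) * ((2 * L) powr p / L\<^sup>2)"
          by (simp add: power2_eq_square algebra_simps add_divide_distrib)
        also have "(2 * L) powr p / L\<^sup>2 = 2 powr p * (L powr p / L\<^sup>2)"
          using L0 by (simp add: powr_mult)
        also have "L powr p / L\<^sup>2 = L powr (\<beta> - 3/2)"
        proof -
          have "L powr (\<beta> - 3/2) = L powr (p - 2)" by (simp add: p_def)
          also have "\<dots> = L powr p / L\<^sup>2" using L0 by (subst powr_diff) simp
          finally show ?thesis by simp
        qed
        finally have "Q * (t powr p * \<eta>2 t + 2 * p * t powr (p - 1) * \<eta>1 t) \<ge>
           Q * (- (B * (1 + 2 * p) * (2 powr p * L powr (\<beta> - 3/2))))"
          using Q0 by (rule mult_left_mono)
        then show ?thesis using True qQ by (simp add: C'_def mult.assoc)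
      next
        case False
        then have "\<eta>1 t = 0"
        proof -
          have "t / L - 1 \<le> 0 \<or> 1 \<le> t / L - 1" using False L0 by (auto simp: field_simps)
          then show ?thesis by (simp add: \<eta>1_def s(3))
        qed
        moreover have "\<eta>2 t = 0"
        proof -
          have "t / L - 1 < 0 \<or> 1 < t / L - 1" using False L0 by (auto simp: field_simps)
          then have "deriv (deriv s) (t / L - 1) = 0"
            by (rule deriv_eq_0_outside[of 0 1, rotated]) (auto simp: s(3))
          then show ?thesis by (simp add: \<eta>2_def)
        qed
        ultimately show ?thesis using False by simp
      qed
      show ?thesis using main b1 b2 by linarith
    qed
    with dd sm\<psi> \<psi>nn \<psi>0 show ?thesis by (intro exI[of _ \<psi>]) simp
  qed
  with C0 show ?thesis by (intro exI[of _ C'] conjI allI impI)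
qed

section \<open>Reduction to the radial variable\<close>

text \<open>Rescalings P(m z - 1)/m, m = n + 1, of a single smooth convex P with slope in [0, 1],
  equal to 0 on the left and of slope 1 from 1 on. The second derivative grows with m, but only its
  sign is needed.\<close>

lemma convex_approx_exists:
  obtains G :: "nat \<Rightarrow> real \<Rightarrow> real" where "\<And>n. smooth_real UNIV (G n)"
    "\<And>n z. z \<le> 1 / real (Suc n) \<Longrightarrow> G n z = 0"
    "\<And>n z. G n z \<ge> 0" "\<And>n z. z \<ge> 0 \<Longrightarrow> G n z \<le> z"
    "\<And>n z. deriv (G n) z \<ge> 0" "\<And>n z. deriv (G n) z \<le> 1" "\<And>n z. deriv (deriv (G n)) z \<ge> 0"
    "\<And>z. z > 0 \<Longrightarrow> (\<lambda>n. G n z) \<longlonglongrightarrow> z" "\<And>z. z > 0 \<Longrightarrow> (\<lambda>n. deriv (G n) z) \<longlonglongrightarrow> 1"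
proof -
  obtain s :: "real \<Rightarrow> real" where s: "smooth_real UNIV s" "\<And>t. deriv s t \<ge> 0"
    "\<And>t. t \<le> 0 \<Longrightarrow> s t = 0" "\<And>t. t \<ge> 1 \<Longrightarrow> s t = 1" "\<And>t. s t \<ge> 0" "\<And>t. s t \<le> 1"
    using smooth_step_exists by metis
  obtain P where P: "\<And>t. (P has_real_derivative s t) (at t)" "\<And>t. t \<le> 0 \<Longrightarrow> P t = 0"
    using antiderivative_from_left[OF smooth_real_continuous[OF s(1)], of 0] s(3) by blast
  have smP: "smooth_real UNIV P" by (rule smooth_real_antideriv[OF _ s(1)]) (use P in auto)
  have Pmono: "P x \<le> P y" if "x \<le> y" for x y
    by (rule DERIV_nonneg_imp_nondecreasing[OF that]) (use P s in blast)
  have Pnn: "P t \<ge> 0" for t using Pmono[of "min t 0" t] P(2)[of "min t 0"] by simp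
  have D: "((\<lambda>t. P t - t) has_real_derivative s t - 1) (at t)" for t
    by (rule DERIV_diff[OF P(1) DERIV_ident])
  have Ple: "P t \<le> t" if "t \<ge> 0" for t
  proof -
    have "P t - t \<le> P 0 - 0"
      by (rule DERIV_nonpos_imp_nonincreasing[OF that]) (use D s(6) in force)
    then show ?thesis using P(2)[of 0] by simp
  qed
  have Pge: "t - 1 \<le> P t" for t
  proof (cases "t \<le> 1")
    case True
    then show ?thesis using Pnn[of t] by simp
  next
    case False
    have "P t - t = P 1 - 1"
    proof (rule DERIV_zero_constant_on_interval[of 1 "\<lambda>t. P t - t"])
      show "((\<lambda>t. P t - t) has_real_derivative 0) (at t)" if "1 \<le> t" for t
        using D[of t] s(4)[OF that] by simp
    qed (use False in simp)
    then show ?thesis using Pnn[of 1] by simp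
  qed
  define G where "G n z = (1 / real (Suc n)) * P (real (Suc n) * z + (-1))" for n z
  have D1: "(G n has_real_derivative s (real (Suc n) * z + (-1))) (at z)" for n z
  proof -
    have "((\<lambda>z. P (real (Suc n) * z + (-1))) has_real_derivative s (real (Suc n) * z + (-1)) * real (Suc n)) (at z)"
      by (rule DERIV_chain2[OF P(1)]) (auto intro!: derivative_eq_intros)
    from DERIV_cmult[OF this, of "1 / real (Suc n)"] show ?thesis by (simp add: G_def[abs_def])
  qed
  then have dG: "deriv (G n) = (\<lambda>z. s (real (Suc n) * z + (-1)))" for n
    by (auto intro!: DERIV_imp_deriv)
  have D2: "(deriv (G n) has_real_derivative deriv s (real (Suc n) * z + (-1)) * real (Suc n)) (at z)" for n z
    unfolding dG
    by (rule DERIV_chain2[OF smooth_real_DERIV[OF s(1) UNIV_I]]) (auto intro!: derivative_eq_intros)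
  have Gle: "G n z \<le> z" if "z \<ge> 0" for n z
  proof (cases "real (Suc n) * z - 1 \<ge> 0")
    case True
    then show ?thesis using Ple[of "real (Suc n) * z + (-1)"] by (simp add: G_def field_simps)
  next
    case False
    then show ?thesis using P(2)[of "real (Suc n) * z + (-1)"] that by (simp add: G_def)
  qed
  \<comment> \<open>From P(t) \<ge> t - 1 at t = m z - 1: one 1/m is lost in P, another in the
    shift.\<close>
  have Gge: "z - 2 * inverse (real (Suc n)) \<le> G n z" for n z
  proof -
    have "z - 2 * inverse N \<le> (1 / N) * P (N * z + (-1))" if "N > 0" for N
    proof -
      have "N * (N * z) \<le> N * (2 + P (N * z + (-1)))"
        using Pge[of "N * z + (-1)"] that by (intro mult_left_mono) auto
      then show ?thesis using that by (simp add: field_simps)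
    qed
    then show ?thesis unfolding G_def by simp
  qed
  show ?thesis
  proof (rule that[of G])
    show "smooth_real UNIV (G n)" for n unfolding G_def[abs_def]
      by (intro smooth_real_mult smooth_real_const smooth_real_comp_affine smP open_UNIV)
    show "G n z = 0" if "z \<le> 1 / real (Suc n)" for n z
      using that P(2)[of "real (Suc n) * z + (-1)"] by (simp add: G_def field_simps)
    show "(\<lambda>n. G n z) \<longlonglongrightarrow> z" if "z > 0" for z
    proof (rule tendsto_sandwich)
      show "\<forall>\<^sub>F n in sequentially. z - 2 * inverse (real (Suc n)) \<le> G n z" using Gge by simp
      show "\<forall>\<^sub>F n in sequentially. G n z \<le> z" using Gle that by simp
      show "(\<lambda>n. z - 2 * inverse (real (Suc n))) \<longlonglongrightarrow> z"
        using tendsto_diff[OF tendsto_const tendsto_mult[OF tendsto_const LIMSEQ_inverse_real_of_nat], of z 2] by simp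
    qed simp
    show "(\<lambda>n. deriv (G n) z) \<longlonglongrightarrow> 1" if "z > 0" for z
    \<comment> \<open>The slope is exactly 1 as soon as (n + 1) z \<ge> 2.\<close>
    proof (rule tendsto_eventually)
      obtain m where m: "2 / z < real m" using reals_Archimedean2 by blast
      show "\<forall>\<^sub>F n in sequentially. deriv (G n) z = 1"
      proof (rule eventually_sequentiallyI[of m])
        fix n assume "m \<le> n"
        then have "2 / z \<le> real (Suc n)" using m by simp
        then have "2 \<le> real (Suc n) * z" using that by (simp add: field_simps)
        then show "deriv (G n) z = 1" unfolding dG by (intro s(4)) simp
      qed
    qed
  qed (use Gle Pnn DERIV_imp_deriv[OF D2] s in \<open>auto simp: dG G_def\<close>)
qed

section \<open>Integrability on the half ball\<close>

lemma borel_measurable_lebesgue_on: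
  "f \<in> borel_measurable borel \<Longrightarrow> f \<in> borel_measurable (lebesgue_on S)"
  by (intro measurable_restrict_space1 measurable_completion) simp

lemma half_ball_measurable: "half_ball \<nu> R \<in> lmeasurable"
  unfolding half_ball_def
  by (intro fmeasurable_Int_fmeasurable lmeasurable_ball) (simp add: lmeasurable_iff_has_integral borel_open open_halfspace_gt)

lemma half_ball_norm:
  assumes "x \<in> half_ball \<nu> R" "R \<le> 1"
  shows "0 < norm x" "norm x < R" "norm x < 1" "ln (norm x) < 0"
proof -
  show 1: "0 < norm x" using assms by (auto simp: half_ball_def)
  show "norm x < R" using assms by (simp add: half_ball_def)
  then show "norm x < 1" using assms by simp
  with 1 show "ln (norm x) < 0" by simp
qed

lemma integrable_weighted_square:
  assumes "u \<in> weighted_L2 \<Omega> w" "w \<in> borel_measurable borel" "\<And>x. x \<in> \<Omega> \<Longrightarrow> w x \<ge> 0" "\<Omega> \<in> sets lebesgue"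
  shows "integrable (lebesgue_on \<Omega>) (\<lambda>x. (u x)\<^sup>2 * w x)"
proof (rule integrableI_nonneg)
  have u: "u \<in> borel_measurable (lebesgue_on \<Omega>)" using assms by (simp add: weighted_L2_def)
  show "(\<lambda>x. (u x)\<^sup>2 * w x) \<in> borel_measurable (lebesgue_on \<Omega>)"
    using u borel_measurable_lebesgue_on[OF assms(2)] by measurable
  show "AE x in lebesgue_on \<Omega>. 0 \<le> (u x)\<^sup>2 * w x"
    by (rule AE_I2) (use assms(3,4) in auto)
  show "(\<integral>\<^sup>+ x. ennreal ((u x)\<^sup>2 * w x) \<partial>lebesgue_on \<Omega>) < \<infinity>"
    using assms(1) by (simp add: weighted_L2_def)
qed

abbreviation (input) log_weight :: "real \<Rightarrow> 'a::euclidean_space \<Rightarrow> real" where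
  "log_weight \<gamma> x \<equiv> norm x powi (-2) * \<bar>ln (norm x)\<bar> powr (-2 * \<gamma>)"

text \<open>Local integrability says nothing near the flat boundary, which the annulus touches.
  There the weighted L^2 hypothesis takes over: on a closed annulus with 0 < a \<le> t \<le> b the
  weight is at least some c > 0, and |u| \<le> 1 + u^2 on a set of finite measure.\<close>

lemma integrable_annulus:
  fixes u f :: "'a::euclidean_space \<Rightarrow> real"
  assumes u: "u \<in> weighted_L2 (half_ball \<nu> R) (log_weight \<gamma>)" and R: "R \<le> 1" and a: "0 < a"
    and f: "continuous_on {x. exp (-b) \<le> norm x \<and> norm x \<le> exp (-a)} f"
    and f0: "\<And>x. x \<in> half_ball \<nu> R \<Longrightarrow> norm x < exp (-b) \<or> exp (-a) < norm x \<Longrightarrow> f x = 0"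
  shows "integrable (lebesgue_on (half_ball \<nu> R)) (\<lambda>x. u x * f x)"
proof -
  let ?M = "lebesgue_on (half_ball \<nu> R)"
  let ?K = "{x::'a. exp (-b) \<le> norm x \<and> norm x \<le> exp (-a)}"
  have \<Omega>: "half_ball \<nu> R \<in> sets lebesgue" using half_ball_measurable by blast
  have spM: "space ?M = half_ball \<nu> R" using \<Omega> by (simp add: space_restrict_space)
  have "?K = cball 0 (exp (-a)) - ball 0 (exp (-b))" by auto
  then have cK: "compact ?K" by (simp add: compact_diff)
  obtain B where B: "B > 0" "\<And>x. x \<in> ?K \<Longrightarrow> \<bar>f x\<bar> \<le> B"
    using compact_imp_bounded[OF compact_continuous_image[OF f cK]] unfolding bounded_pos by auto
  \<comment> \<open>The power t^(-2 \<gamma>) is monotone, in a direction depending on the sign of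
    \<gamma>, so its minimum over [a, b] sits at an endpoint. The factor |x|^(-2) is at least
    1.\<close>
  define c where "c = min (a powr (-2 * \<gamma>)) (\<bar>b\<bar> powr (-2 * \<gamma>))"
  interpret finite_measure ?M by (rule finite_measure_lebesgue_on[OF half_ball_measurable])
  have i2: "integrable ?M (\<lambda>x. (u x)\<^sup>2 * log_weight \<gamma> x)"
    using \<Omega> by (intro integrable_weighted_square[OF u]) (auto simp: power_int_minus)
  have um: "u \<in> borel_measurable ?M" using u by (simp add: weighted_L2_def)
  have mf: "(\<lambda>x. indicator ?K x *\<^sub>R f x) \<in> borel_measurable ?M"
    by (intro borel_measurable_lebesgue_on borel_measurable_continuous_on_indicator f)
       (use compact_imp_closed[OF cK] in auto)
  have eq: "u x * f x = u x * (indicator ?K x *\<^sub>R f x)" if "x \<in> half_ball \<nu> R" for x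
    using f0[OF that] by (cases "x \<in> ?K") (auto simp: not_le)
  have fm: "(\<lambda>x. u x * f x) \<in> borel_measurable ?M"
    by (subst measurable_cong[OF eq]) (use spM um mf in \<open>auto intro!: borel_measurable_times\<close>)
  show ?thesis
  proof (cases "a \<le> b")
    case False
    \<comment> \<open>For b < a the annulus is empty and f vanishes on the whole half ball.\<close>
    have fz: "f x = 0" if "x \<in> half_ball \<nu> R" for x
      using f0[OF that] False by (smt (verit) exp_less_mono)
    have "integrable ?M (\<lambda>x. u x * f x) = integrable ?M (\<lambda>x. 0 :: real)"
      by (rule Bochner_Integration.integrable_cong) (auto simp: spM fz)
    then show ?thesis by simp
  next
    case True
    then have c0: "c > 0" using a by (simp add: c_def)
    show ?thesis
    proof (rule Bochner_Integration.integrable_bound[OF _ fm])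
      show "integrable ?M (\<lambda>x. B * (1 + (u x)\<^sup>2 * log_weight \<gamma> x / c))"
        by (intro integrable_mult_right integrable_divide Bochner_Integration.integrable_add i2 integrable_const)
      show "AE x in ?M. norm (u x * f x) \<le> norm (B * (1 + (u x)\<^sup>2 * log_weight \<gamma> x / c))"
      proof (rule AE_I2)
        fix x assume "x \<in> space ?M"
        then have x: "x \<in> half_ball \<nu> R" by (simp add: spM)
        note nx = half_ball_norm[OF x R]
        have w0: "log_weight \<gamma> x \<ge> 0" by simp
        show "norm (u x * f x) \<le> norm (B * (1 + (u x)\<^sup>2 * log_weight \<gamma> x / c))"
        proof (cases "x \<in> ?K")
          case False
          then have "f x = 0" using f0[OF x] by auto
          then show ?thesis by simp
        next
          case xK: True
          define t where "t = \<bar>ln (norm x)\<bar>"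
          have t: "a \<le> t" "t \<le> b" "t > 0"
          proof -
            have "ln (exp (-b)) \<le> ln (norm x)" using xK nx by (subst ln_le_cancel_iff) auto
            moreover have "ln (norm x) \<le> ln (exp (-a))" using xK nx by (subst ln_le_cancel_iff) auto
            ultimately show "a \<le> t" "t \<le> b" "t > 0" using nx a by (auto simp: t_def)
          qed
          have "c \<le> t powr (-2 * \<gamma>)"
          proof (cases "\<gamma> \<ge> 0")
            case True
            have "\<bar>b\<bar> powr (-2 * \<gamma>) \<le> t powr (-2 * \<gamma>)"
              using t True by (intro powr_mono2') auto
            then show ?thesis by (simp add: c_def)
          next
            case False
            have "a powr (-2 * \<gamma>) \<le> t powr (-2 * \<gamma>)"
              using t a False by (intro powr_mono2) auto
            then show ?thesis by (simp add: c_def)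
          qed
          moreover have "1 \<le> norm x powi (-2)"
          proof -
            have "(norm x)\<^sup>2 \<le> 1" using nx by (simp add: power_le_one)
            then show ?thesis using nx by (simp add: power_int_minus one_le_inverse_iff)
          qed
          ultimately have "1 * c \<le> log_weight \<gamma> x"
            unfolding t_def using c0 by (intro mult_mono) auto
          then have "1 \<le> log_weight \<gamma> x / c" using c0 by (simp add: field_simps)
          then have "(u x)\<^sup>2 * 1 \<le> (u x)\<^sup>2 * (log_weight \<gamma> x / c)" by (intro mult_left_mono) auto
          moreover have "\<bar>u x\<bar> \<le> 1 + (u x)\<^sup>2"
          proof -
            have "0 \<le> (\<bar>u x\<bar> - 1/2)\<^sup>2" by simp
            then show ?thesis by (simp add: power2_eq_square algebra_simps)
          qed
          ultimately have "\<bar>u x\<bar> \<le> 1 + (u x)\<^sup>2 * log_weight \<gamma> x / c" by simp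
          then have "\<bar>f x\<bar> * \<bar>u x\<bar> \<le> B * (1 + (u x)\<^sup>2 * log_weight \<gamma> x / c)"
            using B xK by (intro mult_mono) auto
          also have "\<dots> \<le> norm (B * (1 + (u x)\<^sup>2 * log_weight \<gamma> x / c))"
            unfolding real_norm_def by (rule abs_ge_self)
          also have "\<bar>f x\<bar> * \<bar>u x\<bar> = norm (u x * f x)" by (simp add: abs_mult)
          finally show ?thesis .
        qed
      qed
    qed
  qed
qed

text \<open>H(s) is |x|^(-N/2) psi(t) in terms of s = |x|^2. The left side is the Laplacian of z
  H(|x|^2) plus potential, divided by z; the extra 4 H' is the gradient cross term, the effect of
  passing to dimension N + 2. The constant c may be chosen anew at every s, which allows
  c/(log|x|)^2 later.\<close>

lemma radial_profile_exists:
  fixes \<psi> :: "real \<Rightarrow> real" and N :: real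
  assumes \<psi>: "smooth_real UNIV \<psi>" "\<And>t. \<psi> t \<ge> 0" "\<And>t. t \<le> a \<or> b \<le> t \<Longrightarrow> \<psi> t = 0"
  obtains H where "smooth_real UNIV H" "\<And>s. H s \<ge> 0"
    "\<And>s. s < exp (-2 * b) \<or> exp (-2 * a) < s \<Longrightarrow> H s = 0"
    "\<And>s c. s > 0 \<Longrightarrow> 4 * s * deriv (deriv H) s + (2 * N + 4) * deriv H s
       + (N\<^sup>2 / 4 + c) / s * H s
       = s powr (-N/4 - 1) * (deriv (deriv \<psi>) (- ln s / 2) + c * \<psi> (- ln s / 2))"
proof -
  define y where "y s = - ln s / 2" for s :: real
  define m where "m = N / 4"
  \<comment> \<open>Extending by 0 to s \<le> 0 is smooth, because psi vanishes for t \<ge> b, that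
    is, for all small s > 0.\<close>
  define H where "H s = (if s \<le> 0 then 0 else s powr (-m) * \<psi> (y s))" for s
  have Dy: "(y has_real_derivative - inverse s / 2) (at s)" if "s > 0" for s
    unfolding y_def[abs_def] using that by (auto intro!: derivative_eq_intros simp: field_simps)
  have D\<psi>: "((\<lambda>s. \<psi> (y s)) has_real_derivative deriv \<psi> (y s) * (- inverse s / 2)) (at s)"
    if "s > 0" for s
    by (rule DERIV_chain2[OF smooth_real_DERIV[OF \<psi>(1) UNIV_I] Dy[OF that]])
  have D\<psi>1: "((\<lambda>s. deriv \<psi> (y s)) has_real_derivative deriv (deriv \<psi>) (y s) * (- inverse s / 2)) (at s)"
    if "s > 0" for s
    by (rule DERIV_chain2[OF smooth_real_DERIV[OF smooth_real_deriv[OF \<psi>(1)] UNIV_I] Dy[OF that]])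
  have Dp: "((\<lambda>s. s powr r) has_real_derivative r * s powr (r - 1)) (at s)" if "s > 0" for s r
    using that by (auto intro!: derivative_eq_intros)
  have inv: "s powr r * inverse s = s powr (r - 1)" if "s > 0" for s r :: real
    using that by (simp add: powr_diff divide_inverse)
  have ps: "s powr r' = s powr r * s" if "s > 0" "r' = r + 1" for s r r' :: real
    using that by (simp add: powr_add)
  define h1 where "h1 s = s powr (-m - 1) * (- m * \<psi> (y s) - deriv \<psi> (y s) / 2)" for s
  define h2 where "h2 s = s powr (-m - 2) *
    (m * (m + 1) * \<psi> (y s) + (m + 1/2) * deriv \<psi> (y s) + deriv (deriv \<psi>) (y s) / 4)" for s
  have D1': "((\<lambda>s. s powr (-m) * \<psi> (y s)) has_real_derivative h1 s) (at s)" if "s > 0" for s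
    by (rule DERIV_cong[OF DERIV_mult[OF Dp[OF that] D\<psi>[OF that]]])
       (simp add: h1_def inv[OF that, symmetric] algebra_simps)
  have D1: "(H has_real_derivative h1 s) (at s)" if "s > 0" for s
    by (rule has_field_derivative_transform_within_open[OF D1'[OF that], of "{0<..}"])
       (use that in \<open>auto simp: H_def\<close>)
  have D2: "(h1 has_real_derivative h2 s) (at s)" if "s > 0" for s
  proof -
    have i: "s powr (-m - 1) = s powr (-m - 2) * s"
      by (rule ps[OF that]) simp
    define w where "w = s powr (-m - 2)"
    have j: "s powr (-m - 1 - 1) = w" "s powr (-m - 1) = w * s" "h2 s = w *
      (m * (m + 1) * \<psi> (y s) + (m + 1/2) * deriv \<psi> (y s) + deriv (deriv \<psi>) (y s) / 4)"
      unfolding w_def h2_def using i by (auto intro: arg_cong[where f = "\<lambda>r. s powr r"])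
    show ?thesis unfolding h1_def[abs_def]
      by (rule DERIV_cong[OF DERIV_mult[OF Dp[OF that] DERIV_diff[OF DERIV_cmult[OF D\<psi>[OF that]]
          DERIV_cdivide[OF D\<psi>1[OF that]]]]])
         (use that in \<open>unfold j, simp add: field_simps\<close>)
  qed
  have dd: "deriv (deriv H) s = h2 s" "deriv H s = h1 s" if "s > 0" for s
    using deriv_deriv_eqI[of "{0<..}" H h1 h2 s] D1 D2 that DERIV_imp_deriv[OF D1[OF that]] by auto
  have H0: "H s = 0" if "s < exp (-2 * b) \<or> exp (-2 * a) < s" for s
  proof (cases "s \<le> 0")
    case False
    then have s: "s > 0" by simp
    have "ln s < -2 * b \<or> -2 * a < ln s"
      using that s by (metis exp_less_cancel_iff exp_ln)
    then have "y s \<le> a \<or> b \<le> y s" by (auto simp: y_def)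
    then show ?thesis by (simp add: H_def \<psi>(3))
  qed (simp add: H_def)
  have smy: "smooth_real {0<..} y"
  proof -
    have "smooth_real {0<..} (\<lambda>s. (\<lambda>z. (-1/2) * z + 0) (ln s))"
      by (rule smooth_real_comp[OF _ smooth_real_affine smooth_real_ln]) auto
    then show ?thesis by (simp add: y_def[abs_def])
  qed
  have "smooth_real {0<..} (\<lambda>s. s powr (-m) * \<psi> (y s))"
    by (intro smooth_real_mult smooth_real_powr smooth_real_comp[OF _ \<psi>(1) smy]) auto
  then have "smooth_real {0<..} H"
    by (rule smooth_real_cong[rotated]) (auto simp: H_def)
  moreover have "smooth_real {..<exp (-2 * b)} H"
    by (rule smooth_real_cong[OF _ smooth_real_subset[OF smooth_real_const[of 0]]])
       (use H0 in auto)
  ultimately have "smooth_real ({0<..} \<union> {..<exp (-2 * b)}) H" by (rule smooth_real_Un)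
  moreover have "{0<..} \<union> {..<exp (-2 * b)} = (UNIV :: real set)"
    by (auto simp: not_less intro: le_less_trans[OF _ exp_gt_zero])
  ultimately have smH: "smooth_real UNIV H" by simp
  show ?thesis
  proof (rule that[of H])
    show "H s \<ge> 0" for s using \<psi>(2) by (simp add: H_def)
    fix s c :: real assume s: "s > 0"
    have i: "s powr (-N/4 - 1) = s powr (-m - 1)" by (simp add: m_def)
    have j: "s powr (-m) = s powr (-m - 1) * s" "s * s powr (-m - 2) = s powr (-m - 1)"
      using ps[OF s, of "-m" "-m - 1"] ps[OF s, of "-m - 1" "-m - 2"] by (simp_all add: mult.commute)
    have N: "N = 4 * m" by (simp add: m_def)
    have "4 * s * h2 s + (2 * N + 4) * h1 s + (N\<^sup>2 / 4 + c) / s * H s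
      = 4 * (s * s powr (-m - 2)) *
          (m * (m + 1) * \<psi> (y s) + (m + 1/2) * deriv \<psi> (y s) + deriv (deriv \<psi>) (y s) / 4)
        + s powr (-m - 1) * ((2 * N + 4) * (- m * \<psi> (y s) - deriv \<psi> (y s) / 2)
        + (N\<^sup>2 / 4 + c) * \<psi> (y s))"
    proof -
      have "(N\<^sup>2 / 4 + c) / s * H s = s powr (-m - 1) * ((N\<^sup>2 / 4 + c) * \<psi> (y s))"
        using s by (simp add: H_def j)
      then show ?thesis unfolding h1_def h2_def by (simp only: distrib_left mult_ac add_ac)
    qed
    \<comment> \<open>With N = 4m the coefficient of psi is 4m(m+1) - (8m+4)m + 4m^2 + c = c, and
      that of psi' is 4m + 2 - (4m + 2) = 0: the choice of the power of s kills both.\<close>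
    also have "\<dots> = s powr (-m - 1) * (deriv (deriv \<psi>) (y s) + c * \<psi> (y s))"
      unfolding j N by (simp add: power2_eq_square algebra_simps)
    finally show "4 * s * deriv (deriv H) s + (2 * N + 4) * deriv H s + (N\<^sup>2 / 4 + c) / s * H s
       = s powr (-N/4 - 1) * (deriv (deriv \<psi>) (- ln s / 2) + c * \<psi> (- ln s / 2))"
      unfolding i dd[OF s] y_def .
  qed (use smH H0 in auto)
qed

section \<open>From the distributional inequality to an inequality in t\<close>

lemma set_integral_eq_lebesgue_on:
  "\<Omega> \<in> sets lebesgue \<Longrightarrow> (LINT x:\<Omega>|lebesgue. f x) = integral\<^sup>L (lebesgue_on \<Omega>) (f :: _ \<Rightarrow> real)"
  by (simp add: set_lebesgue_integral_def integral_restrict_space)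

text \<open>The admissible functions are \<open>G n\<close> of the height times H; the factor z
  appears only in the limit n to infinity. Nonnegativity of u enters twice, in replacing \<alpha> by
  c and in discarding the term with the second derivative of \<open>G n\<close>.\<close>

lemma radial_inequality:
  fixes u :: "'a::euclidean_space \<Rightarrow> real" and \<nu> :: 'a
  assumes sol: "distributional_solution (half_ball \<nu> R) \<alpha> u"
    and unn: "AE x in lebesgue_on (half_ball \<nu> R). u x \<ge> 0"
    and u: "u \<in> weighted_L2 (half_ball \<nu> R) (log_weight \<gamma>)"
    and R: "R \<le> 1" and a: "0 < a" "exp (-a) < R" and c: "c \<le> \<alpha>"
    and \<psi>: "smooth_real UNIV \<psi>" "\<And>t. \<psi> t \<ge> 0" "\<And>t. t \<le> a \<or> b \<le> t \<Longrightarrow> \<psi> t = 0"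
  shows "integrable (lebesgue_on (half_ball \<nu> R)) (\<lambda>x. u x * ((\<nu> \<bullet> x) * norm x powr (- real DIM('a) / 2 - 2) *
      (deriv (deriv \<psi>) (- ln (norm x)) + c / (ln (norm x))\<^sup>2 * \<psi> (- ln (norm x)))))" (is "integrable ?M ?I")
    and "(LINT x|lebesgue_on (half_ball \<nu> R). u x * ((\<nu> \<bullet> x) * norm x powr (- real DIM('a) / 2 - 2) *
      (deriv (deriv \<psi>) (- ln (norm x)) + c / (ln (norm x))\<^sup>2 * \<psi> (- ln (norm x))))) \<le> 0"
proof -
  let ?\<Omega> = "half_ball \<nu> R"
  let ?K = "{x::'a. exp (-b) \<le> norm x \<and> norm x \<le> exp (-a)}"
  define N where "N = real DIM('a)"
  have \<Omega>: "?\<Omega> \<in> sets lebesgue" using half_ball_measurable by blast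
  have spM: "space ?M = ?\<Omega>" using \<Omega> by (simp add: space_restrict_space)
  obtain H where H: "smooth_real UNIV H" "\<And>s. H s \<ge> 0"
    and H0: "\<And>s. s < exp (-2 * b) \<or> exp (-2 * a) < s \<Longrightarrow> H s = 0"
    and Heq: "\<And>s c. s > 0 \<Longrightarrow> 4 * s * deriv (deriv H) s + (2 * N + 4) * deriv H s
       + (N\<^sup>2 / 4 + c) / s * H s
       = s powr (-N/4 - 1) * (deriv (deriv \<psi>) (- ln s / 2) + c * \<psi> (- ln s / 2))"
  proof (rule radial_profile_exists[where N = N and a = a and b = b, OF \<psi>], goal_cases)
    case (2 H)
    show ?case by (rule that[OF 2(2-)])
  qed
  have H1: "deriv H s = 0" if "s < exp (-2 * b) \<or> exp (-2 * a) < s" for s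
    using deriv_eq_0_outside[OF H0 that] .
  have H2: "deriv (deriv H) s = 0" if "s < exp (-2 * b) \<or> exp (-2 * a) < s" for s
    using deriv_eq_0_outside[OF H1 that] .
  have out: "x \<bullet> x < exp (-2 * b) \<or> exp (-2 * a) < x \<bullet> x"
    if "norm x < exp (-b) \<or> exp (-a) < norm x" for x :: 'a
  proof -
    have e: "exp (-2 * r) = (exp (-r))\<^sup>2" for r :: real by (simp add: exp_double[symmetric])
    have "(norm x)\<^sup>2 < (exp (-b))\<^sup>2 \<or> (exp (-a))\<^sup>2 < (norm x)\<^sup>2"
      using that power_strict_mono[of "norm x" "exp (-b)" 2] power_strict_mono[of "exp (-a)" "norm x" 2] by auto
    then show ?thesis unfolding e by (simp add: dot_square_norm)
  qed
  have HK: "H (x \<bullet> x) = 0" "deriv H (x \<bullet> x) = 0" "deriv (deriv H) (x \<bullet> x) = 0"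
    if "norm x < exp (-b) \<or> exp (-a) < norm x" for x :: 'a
    using out[OF that] H0 H1 H2 by auto
  obtain G where G: "\<And>n. smooth_real UNIV (G n)"
    "\<And>n z. z \<le> 1 / real (Suc n) \<Longrightarrow> G n z = 0"
    "\<And>n z. G n z \<ge> 0" "\<And>n z. z \<ge> 0 \<Longrightarrow> G n z \<le> z"
    "\<And>n z. deriv (G n) z \<ge> 0" "\<And>n z. deriv (G n) z \<le> 1" "\<And>n z. deriv (deriv (G n)) z \<ge> 0"
    "\<And>z. z > 0 \<Longrightarrow> (\<lambda>n. G n z) \<longlonglongrightarrow> z" "\<And>z. z > 0 \<Longrightarrow> (\<lambda>n. deriv (G n) z) \<longlonglongrightarrow> 1"
  proof (rule convex_approx_exists, goal_cases)
    case (1 G)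
    show ?case by (rule that[OF 1(2-)])
  qed
  define V where "V x = N\<^sup>2 / 4 * norm x powi (-2) + c * (norm x powi (-2) * \<bar>ln (norm x)\<bar> powi (-2))" for x :: 'a
  have contH: "continuous_on S (\<lambda>x::'a. f (x \<bullet> x))" if "smooth_real UNIV f" for f S
    by (rule continuous_on_compose2[OF smooth_real_continuous[OF that]]) (auto intro!: continuous_intros)
  have contG: "continuous_on S (\<lambda>x::'a. f (\<nu> \<bullet> x))" if "smooth_real UNIV f" for f S
    by (rule continuous_on_compose2[OF smooth_real_continuous[OF that]]) (auto intro!: continuous_intros)
  note cH = contH[OF H(1)] contH[OF smooth_real_deriv[OF H(1)]]
    contH[OF smooth_real_deriv[OF smooth_real_deriv[OF H(1)]]]
  note cG = contG[OF G(1)] contG[OF smooth_real_deriv[OF G(1)]]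
    contG[OF smooth_real_deriv[OF smooth_real_deriv[OF G(1)]]]
  have Kpos: "norm x > 0" "ln (norm x) < 0" if "x \<in> ?K" for x
  proof -
    have "0 < exp (-b)" "exp (-b) \<le> norm x" using that by auto
    then show 1: "norm x > 0" by linarith
    have "norm x \<le> exp (-a)" "exp (-a) < 1" using that a by auto
    then have "norm x < 1" by linarith
    then show "ln (norm x) < 0" using 1 by simp
  qed
  have cn: "continuous_on ?K (\<lambda>x. norm x powi (-2))"
    by (intro continuous_intros) (use Kpos in auto)
  have "norm x \<noteq> 0" "\<bar>ln (norm x)\<bar> \<noteq> 0" if "x \<in> ?K" for x using Kpos[OF that] by linarith+
  then have cl: "continuous_on ?K (\<lambda>x. \<bar>ln (norm x)\<bar> powi (-2))"
    by (intro continuous_intros) blast+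
  have cV: "continuous_on ?K V" unfolding V_def[abs_def] by (intro continuous_intros cn cl)
  note int = integrable_annulus[OF u R a(1), of b]
  \<comment> \<open>\<open>F n\<close> is the Laplacian of the test function plus the potential
    times it, without the term |\<nu>|^2 G'' H; \<open>F'\<close> is the same with
    \<open>G n\<close> replaced by the identity, and \<open>D\<close> dominates every
    \<open>F n\<close> since 0 \<le> G \<le> z and 0 \<le> G' \<le> 1.\<close>
  define F where "F n x = 4 * (\<nu> \<bullet> x) * deriv (G n) (\<nu> \<bullet> x) * deriv H (x \<bullet> x)
     + G n (\<nu> \<bullet> x) * (4 * (x \<bullet> x) * deriv (deriv H) (x \<bullet> x) + 2 * N * deriv H (x \<bullet> x) + V x * H (x \<bullet> x))" for n x
  define F' where "F' x = 4 * (\<nu> \<bullet> x) * deriv H (x \<bullet> x)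
     + (\<nu> \<bullet> x) * (4 * (x \<bullet> x) * deriv (deriv H) (x \<bullet> x) + 2 * N * deriv H (x \<bullet> x) + V x * H (x \<bullet> x))" for x
  define D where "D x = 4 * \<bar>\<nu> \<bullet> x\<bar> * \<bar>deriv H (x \<bullet> x)\<bar>
     + \<bar>\<nu> \<bullet> x\<bar> * \<bar>4 * (x \<bullet> x) * deriv (deriv H) (x \<bullet> x) + 2 * N * deriv H (x \<bullet> x) + V x * H (x \<bullet> x)\<bar>" for x
  have iF: "integrable ?M (\<lambda>x. u x * F n x)" for n
    by (rule int) (auto simp: F_def HK intro!: continuous_intros cH cG cV)
  have iF': "integrable ?M (\<lambda>x. u x * F' x)"
    by (rule int) (auto simp: F'_def HK intro!: continuous_intros cH cG cV)
  have iD: "integrable ?M (\<lambda>x. u x * D x)"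
    by (rule int) (auto simp: D_def HK intro!: continuous_intros cH cG cV)
  have neg: "(LINT x|?M. u x * F n x) \<le> 0" for n
  proof -
    define \<phi> where "\<phi> x = G n (\<nu> \<bullet> x) * H (x \<bullet> x)" for x
    have \<phi>nn: "\<phi> x \<ge> 0" for x using G(3) H(2) by (simp add: \<phi>_def)
    have H0': "H s = 0" if "(exp (-a))\<^sup>2 < s" for s
      using H0[of s] that by (simp add: exp_double[symmetric])
    have "test_function_on ?\<Omega> \<phi>" unfolding \<phi>_def[abs_def]
      by (rule test_function_height_radial[where \<epsilon> = "1 / real (Suc n)" and r = "exp (-a)",
            OF G(1) H(1) G(2) _ H0']) (use a in auto)
    with sol \<phi>nn have "- (LINT x:?\<Omega>|lebesgue. u x * laplacian \<phi> x)
        - (real DIM('a))\<^sup>2 / 4 * (LINT x:?\<Omega>|lebesgue. norm x powi (-2) * u x * \<phi> x)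
        \<ge> \<alpha> * (LINT x:?\<Omega>|lebesgue. norm x powi (-2) * \<bar>ln (norm x)\<bar> powi (-2) * u x * \<phi> x)"
      unfolding distributional_solution_def by blast
    then have sol': "- (LINT x|?M. u x * laplacian \<phi> x)
        - N\<^sup>2 / 4 * (LINT x|?M. u x * (norm x powi (-2) * \<phi> x))
        \<ge> \<alpha> * (LINT x|?M. u x * (norm x powi (-2) * \<bar>ln (norm x)\<bar> powi (-2) * \<phi> x))"
      unfolding set_integral_eq_lebesgue_on[OF \<Omega>] N_def by (simp add: mult_ac)
    have lap: "laplacian \<phi> x = (\<nu> \<bullet> \<nu>) * deriv (deriv (G n)) (\<nu> \<bullet> x) * H (x \<bullet> x)
      + 4 * (\<nu> \<bullet> x) * deriv (G n) (\<nu> \<bullet> x) * deriv H (x \<bullet> x)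
      + G n (\<nu> \<bullet> x) * (4 * (x \<bullet> x) * deriv (deriv H) (x \<bullet> x) + 2 * N * deriv H (x \<bullet> x))" for x
      unfolding \<phi>_def[abs_def] N_def by (rule laplacian_height_radial[OF G(1) H(1)])
    have c\<phi>: "continuous_on S \<phi>" for S unfolding \<phi>_def[abs_def] by (intro continuous_intros cH cG)
    have i1: "integrable ?M (\<lambda>x. u x * laplacian \<phi> x)"
      by (rule int) (auto simp: lap HK intro!: continuous_intros cH cG)
    have i2: "integrable ?M (\<lambda>x. u x * (norm x powi (-2) * \<phi> x))"
      by (rule int) (auto simp: \<phi>_def[symmetric] intro!: continuous_intros c\<phi> cn, auto simp: \<phi>_def HK)
    have i3: "integrable ?M (\<lambda>x. u x * (norm x powi (-2) * \<bar>ln (norm x)\<bar> powi (-2) * \<phi> x))"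
      by (rule int) (auto simp: \<phi>_def[symmetric] intro!: continuous_intros c\<phi> cn cl, auto simp: \<phi>_def HK)
    have "0 \<le> (LINT x|?M. u x * (norm x powi (-2) * \<bar>ln (norm x)\<bar> powi (-2) * \<phi> x))"
      by (rule integral_nonneg_AE) (use unn in eventually_elim, use \<phi>nn in simp)
    then have "c * (LINT x|?M. u x * (norm x powi (-2) * \<bar>ln (norm x)\<bar> powi (-2) * \<phi> x))
        \<le> \<alpha> * (LINT x|?M. u x * (norm x powi (-2) * \<bar>ln (norm x)\<bar> powi (-2) * \<phi> x))"
      using c by (rule mult_right_mono[rotated])
    with sol' have le: "(LINT x|?M. u x * laplacian \<phi> x)
        + (N\<^sup>2 / 4 * (LINT x|?M. u x * (norm x powi (-2) * \<phi> x))
        + c * (LINT x|?M. u x * (norm x powi (-2) * \<bar>ln (norm x)\<bar> powi (-2) * \<phi> x))) \<le> 0" by linarith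
    have "(LINT x|?M. u x * F n x) \<le> (LINT x|?M. u x * laplacian \<phi> x +
        (N\<^sup>2 / 4 * (u x * (norm x powi (-2) * \<phi> x))
        + c * (u x * (norm x powi (-2) * \<bar>ln (norm x)\<bar> powi (-2) * \<phi> x))))"
    proof (rule integral_mono_AE[OF iF])
      show "integrable ?M (\<lambda>x. u x * laplacian \<phi> x +
        (N\<^sup>2 / 4 * (u x * (norm x powi (-2) * \<phi> x))
        + c * (u x * (norm x powi (-2) * \<bar>ln (norm x)\<bar> powi (-2) * \<phi> x))))"
        by (intro Bochner_Integration.integrable_add integrable_mult_right i1 i2 i3)
      show "AE x in ?M. u x * F n x \<le> u x * laplacian \<phi> x +
        (N\<^sup>2 / 4 * (u x * (norm x powi (-2) * \<phi> x))
        + c * (u x * (norm x powi (-2) * \<bar>ln (norm x)\<bar> powi (-2) * \<phi> x)))"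
        using unn
      proof eventually_elim
        case (elim x)
        \<comment> \<open>What separates the two integrands is exactly the convexity term.\<close>
        have "u x * laplacian \<phi> x + (N\<^sup>2 / 4 * (u x * (norm x powi (-2) * \<phi> x))
          + c * (u x * (norm x powi (-2) * \<bar>ln (norm x)\<bar> powi (-2) * \<phi> x))) - u x * F n x
          = u x * ((\<nu> \<bullet> \<nu>) * deriv (deriv (G n)) (\<nu> \<bullet> x) * H (x \<bullet> x))"
          unfolding lap F_def V_def \<phi>_def by (simp add: algebra_simps)
        moreover have "\<dots> \<ge> 0" using elim G(7) H(2) by simp
        ultimately show ?case by linarith
      qed
    qed
    also have "\<dots> = (LINT x|?M. u x * laplacian \<phi> x)
        + (N\<^sup>2 / 4 * (LINT x|?M. u x * (norm x powi (-2) * \<phi> x))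
        + c * (LINT x|?M. u x * (norm x powi (-2) * \<bar>ln (norm x)\<bar> powi (-2) * \<phi> x)))"
      using i1 i2 i3 by simp
    finally show ?thesis using le by linarith
  qed
  have lim: "(\<lambda>n. LINT x|?M. u x * F n x) \<longlonglongrightarrow> (LINT x|?M. u x * F' x)"
  proof (rule integral_dominated_convergence[where w = "\<lambda>x. \<bar>u x * D x\<bar>"])
    show "integrable ?M (\<lambda>x. \<bar>u x * D x\<bar>)" using iD by simp
    show "AE x in ?M. (\<lambda>n. u x * F n x) \<longlonglongrightarrow> u x * F' x"
    proof (rule AE_I2)
      fix x assume "x \<in> space ?M"
      then have z: "\<nu> \<bullet> x > 0" by (simp add: spM half_ball_def)
      have "F' x = 4 * (\<nu> \<bullet> x) * 1 * deriv H (x \<bullet> x)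
     + (\<nu> \<bullet> x) * (4 * (x \<bullet> x) * deriv (deriv H) (x \<bullet> x) + 2 * N * deriv H (x \<bullet> x) + V x * H (x \<bullet> x))"
        by (simp add: F'_def)
      then show "(\<lambda>n. u x * F n x) \<longlonglongrightarrow> u x * F' x"
        unfolding F_def by (simp only:) (intro tendsto_intros G(8,9)[OF z])
    qed
    show "AE x in ?M. norm (u x * F n x) \<le> \<bar>u x * D x\<bar>" for n
    proof (rule AE_I2)
      fix x assume "x \<in> space ?M"
      then have z: "\<nu> \<bullet> x > 0" by (simp add: spM half_ball_def)
      let ?E = "4 * (x \<bullet> x) * deriv (deriv H) (x \<bullet> x) + 2 * N * deriv H (x \<bullet> x) + V x * H (x \<bullet> x)"
      have "\<bar>F n x\<bar> \<le> \<bar>4 * (\<nu> \<bullet> x) * deriv (G n) (\<nu> \<bullet> x) * deriv H (x \<bullet> x)\<bar> + \<bar>G n (\<nu> \<bullet> x) * ?E\<bar>"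
        unfolding F_def by (rule abs_triangle_ineq)
      also have "\<dots> = 4 * \<bar>\<nu> \<bullet> x\<bar> * deriv (G n) (\<nu> \<bullet> x) * \<bar>deriv H (x \<bullet> x)\<bar> + G n (\<nu> \<bullet> x) * \<bar>?E\<bar>"
        using G(3,5) by (simp add: abs_mult)
      also have "\<dots> \<le> 4 * \<bar>\<nu> \<bullet> x\<bar> * 1 * \<bar>deriv H (x \<bullet> x)\<bar> + \<bar>\<nu> \<bullet> x\<bar> * \<bar>?E\<bar>"
        using G(3,4,5,6) z by (intro add_mono mult_right_mono mult_left_mono) auto
      also have "\<dots> = D x" by (simp add: D_def)
      finally have "\<bar>F n x\<bar> \<le> \<bar>D x\<bar>" by linarith
      then show "norm (u x * F n x) \<le> \<bar>u x * D x\<bar>" by (simp add: abs_mult mult_left_mono)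
    qed
  qed (use iF iF' in \<open>auto dest: borel_measurable_integrable\<close>)
  have le0: "(LINT x|?M. u x * F' x) \<le> 0"
    by (rule LIMSEQ_le_const2[OF lim]) (use neg in auto)
  have F'eq: "u x * F' x = ?I x" if "x \<in> space ?M" for x
  proof -
    have x: "norm x > 0" using half_ball_norm[OF _ R] that by (auto simp: spM)
    then have s: "x \<bullet> x > 0" by simp
    have ls: "ln (x \<bullet> x) = 2 * ln (norm x)"
      using x by (simp add: dot_square_norm ln_realpow)
    have ps: "(x \<bullet> x) powr (-N/4 - 1) = norm x powr (- N / 2 - 2)"
    proof -
      have "(x \<bullet> x) powr (-N/4 - 1) = (norm x powr 2) powr (-N/4 - 1)"
        using x by (simp add: dot_square_norm powr_numeral)
      also have "\<dots> = norm x powr (2 * (-N/4 - 1))" by (simp only: powr_powr)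
      also have "2 * (-N/4 - 1) = - N / 2 - 2" by simp
      finally show ?thesis .
    qed
    have Vx: "V x = (N\<^sup>2 / 4 + c / (ln (norm x))\<^sup>2) / (x \<bullet> x)"
      using x by (simp add: V_def dot_square_norm power_int_minus field_simps)
    \<comment> \<open>The cross term, now with slope 1, joins the first-order term: 2N + 4 is 2(N +
      2).\<close>
    have "F' x = (\<nu> \<bullet> x) * (4 * (x \<bullet> x) * deriv (deriv H) (x \<bullet> x) + (2 * N + 4) * deriv H (x \<bullet> x)
        + V x * H (x \<bullet> x))"
      by (simp add: F'_def algebra_simps)
    also have "\<dots> = (\<nu> \<bullet> x) * norm x powr (- N / 2 - 2) *
      (deriv (deriv \<psi>) (- ln (norm x)) + c / (ln (norm x))\<^sup>2 * \<psi> (- ln (norm x)))"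
      using Heq[OF s, of "c / (ln (norm x))\<^sup>2"] unfolding Vx ps ls by simp
    finally show ?thesis by (simp add: N_def mult_ac)
  qed
  have "(LINT x|?M. u x * F' x) = (LINT x|?M. ?I x)"
    by (rule Bochner_Integration.integral_cong[OF refl F'eq])
  with le0 show "(LINT x|?M. ?I x) \<le> 0" by simp
  have "integrable ?M (\<lambda>x. u x * F' x) = integrable ?M ?I"
    by (rule Bochner_Integration.integrable_cong[OF refl F'eq])
  with iF' show "integrable ?M ?I" by simp
qed

section \<open>Mass estimate and conclusion\<close>

text \<open>A substitute for polar coordinates. With k the integer part of t, |x|^(-N) = e^(Nt) is
  at most e^(N(k+1)), and x lies in the ball of radius e^(-k).\<close>

lemma shell_cover:
  fixes x :: "'a::euclidean_space" and n :: nat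
  assumes "x \<noteq> 0" "- ln (norm x) \<in> {real n..2 * real n}" "N \<ge> 0"
  shows "norm x powr (- N) \<le>
    (\<Sum>k=n..2 * n. exp (N * (real k + 1)) * indicator (cball 0 (exp (- real k))) x)"
proof -
  define t where "t = - ln (norm x)"
  define k where "k = nat \<lfloor>t\<rfloor>"
  have t: "real n \<le> t" "t \<le> 2 * real n" using assms(2) by (auto simp: t_def)
  have t0: "t \<ge> 0" using t(1) of_nat_0_le_iff[of n, where 'a = real] by linarith
  have k: "real k \<le> t" "t < real k + 1" using t0 by (auto simp: k_def)
  have "real k \<le> real (2 * n)" using k t by simp
  then have kn2: "k \<le> 2 * n" by (simp only: of_nat_le_iff)
  have "real n < real (k + 1)" using k t by simp
  then have "n < k + 1" by (simp only: of_nat_less_iff)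
  with kn2 have kn: "k \<in> {n..2 * n}" by simp
  have nx: "norm x = exp (- t)" using assms(1) by (simp add: t_def)
  have "norm x powr (- N) = exp (N * t)" by (simp add: nx powr_def)
  also have "\<dots> \<le> exp (N * (real k + 1)) * indicator (cball 0 (exp (- real k))) x"
    using k assms(3) by (simp add: nx mult_left_mono)
  also have "\<dots> \<le> (\<Sum>k=n..2 * n. exp (N * (real k + 1)) * indicator (cball 0 (exp (- real k))) x)"
    by (rule member_le_sum[OF kn]) auto
  finally show ?thesis .
qed

text \<open>The factor e^(N(k+1)) compensates the volume of the ball of radius e^(-k), so each
  summand contributes at most a constant independent of k; there are n + 1 \<le> 2n
  summands.\<close>

lemma shell_sum_integral:
  fixes \<Omega> :: "'a::euclidean_space set" and n :: nat
  defines "S \<equiv> \<lambda>x::'a. \<Sum>k=n..2 * n. exp (DIM('a) * (real k + 1)) * indicator (cball 0 (exp (- real k))) x"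
  assumes \<Omega>: "\<Omega> \<in> sets lebesgue" and n: "n \<ge> 1"
  shows "integrable (lebesgue_on \<Omega>) S"
    and "(LINT x|lebesgue_on \<Omega>. S x) \<le> 2 * unit_ball_vol (DIM('a)) * exp (DIM('a)) * real n"
proof -
  let ?N = "real DIM('a)"
  have cb: "cball (0::'a) r \<in> lmeasurable" for r by (rule lmeasurable_cball)
  have i: "integrable (lebesgue_on \<Omega>) (indicator (cball (0::'a) r) :: 'a \<Rightarrow> real)"
    and m: "(LINT x|lebesgue_on \<Omega>. indicator (cball (0::'a) r) x) \<le> unit_ball_vol ?N * r ^ DIM('a)"
    if "r \<ge> 0" for r
  proof -
    have "integrable lebesgue (\<lambda>x. indicat_real \<Omega> x *\<^sub>R indicat_real (cball 0 r) x)"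
    proof -
      have "\<Omega> \<inter> cball 0 r \<in> lmeasurable" using fmeasurable_Int_fmeasurable[OF cb \<Omega>] by (simp add: Int_commute)
      then have "integrable lebesgue (indicat_real (\<Omega> \<inter> cball 0 r))"
        by (intro integrable_real_indicator) (auto simp: fmeasurable_def)
      moreover have "indicat_real (\<Omega> \<inter> cball 0 r) = (\<lambda>x. indicat_real \<Omega> x *\<^sub>R indicat_real (cball 0 r) x)"
        by (auto simp: indicator_inter_arith)
      ultimately show ?thesis by simp
    qed
    then show "integrable (lebesgue_on \<Omega>) (indicator (cball (0::'a) r) :: 'a \<Rightarrow> real)"
      using \<Omega> by (subst integrable_restrict_space) auto
    have "(LINT x|lebesgue_on \<Omega>. indicat_real (cball 0 r) x)
       = (LINT x|lebesgue. indicat_real \<Omega> x *\<^sub>R indicat_real (cball 0 r) x)"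
      using \<Omega> by (subst integral_restrict_space) auto
    also have "\<dots> \<le> (LINT x|lebesgue. indicat_real (cball (0::'a) r) x)"
    proof (rule integral_mono')
      show "integrable lebesgue (indicat_real (cball (0::'a) r))"
        using cb[of r] by (intro integrable_real_indicator) (auto simp: fmeasurable_def)
    qed (auto simp: indicator_def)
    also have "\<dots> = measure lborel (cball (0::'a) r)" by simp
    also have "\<dots> = unit_ball_vol ?N * r ^ DIM('a)" using that by (rule content_cball)
    finally show "(LINT x|lebesgue_on \<Omega>. indicator (cball (0::'a) r) x) \<le> unit_ball_vol ?N * r ^ DIM('a)" .
  qed
  show "integrable (lebesgue_on \<Omega>) S"
    unfolding S_def by (intro Bochner_Integration.integrable_sum integrable_mult_right i) simp
  have "(LINT x|lebesgue_on \<Omega>. S x)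
      = (\<Sum>k=n..2 * n. exp (?N * (real k + 1)) * (LINT x|lebesgue_on \<Omega>. indicator (cball (0::'a) (exp (- real k))) x))"
    unfolding S_def
    by (subst Bochner_Integration.integral_sum) (auto intro!: integrable_mult_right i)
  also have "\<dots> \<le> (\<Sum>k=n..2 * n. exp (?N * (real k + 1)) * (unit_ball_vol ?N * exp (- real k) ^ DIM('a)))"
    by (intro sum_mono mult_left_mono m) auto
  also have "\<dots> = (\<Sum>k=n..2 * n. unit_ball_vol ?N * exp ?N)"
  proof (rule sum.cong[OF refl])
    fix k
    have "exp (?N * (real k + 1)) * exp (- real k) ^ DIM('a) = exp ?N"
      unfolding exp_of_nat_mult[symmetric] exp_add[symmetric] by (simp add: algebra_simps)
    then show "exp (?N * (real k + 1)) * (unit_ball_vol ?N * exp (- real k) ^ DIM('a)) = unit_ball_vol ?N * exp ?N"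
      by (metis mult.commute mult.left_commute)
  qed
  also have "\<dots> = (real n + 1) * (unit_ball_vol ?N * exp ?N)" by simp
  also have "\<dots> \<le> (2 * real n) * (unit_ball_vol ?N * exp ?N)"
    using n by (intro mult_right_mono mult_nonneg_nonneg) auto
  finally show "(LINT x|lebesgue_on \<Omega>. S x) \<le> 2 * unit_ball_vol ?N * exp ?N * real n"
    by (simp add: mult_ac)
qed

text \<open>The only source of the little-o in the mass estimate.\<close>

lemma weighted_tail_tendsto_0:
  fixes g :: "'a::euclidean_space \<Rightarrow> real"
  assumes "integrable M g" and t: "t \<in> borel_measurable M"
  shows "(\<lambda>n. LINT x|M. indicator {real n..} (t x) * g x) \<longlonglongrightarrow> 0"
proof -
  have g: "g \<in> borel_measurable M" using assms(1) by (rule borel_measurable_integrable)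
  have "(\<lambda>n. LINT x|M. indicator {real n..} (t x) * g x) \<longlonglongrightarrow> (LINT x|M. 0)"
  proof (rule integral_dominated_convergence[where w = "\<lambda>x. \<bar>g x\<bar>"])
    show "AE x in M. (\<lambda>n. indicator {real n..} (t x) * g x) \<longlonglongrightarrow> 0"
    proof (rule AE_I2, rule tendsto_eventually)
      fix x
      obtain m where m: "t x < real m" using reals_Archimedean2 by blast
      show "\<forall>\<^sub>F n in sequentially. indicator {real n..} (t x) * g x = 0"
        by (rule eventually_sequentiallyI[of m]) (use m in \<open>auto simp: indicator_def\<close>)
    qed
    show "(\<lambda>x. indicator {real n..} (t x) * g x) \<in> borel_measurable M" for n
      using g t by measurable
  qed (use assms(1) in \<open>auto simp: indicator_def\<close>)
  then show ?thesis by simp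
qed

text \<open>Serves to pick small parameters d/(p+1) when p may be 0.\<close>

lemma mult_divide_add_one_le: "0 \<le> p \<Longrightarrow> 0 \<le> d \<Longrightarrow> p * (d / (p + 1)) \<le> (d :: real)"
proof -
  assume "0 \<le> p" "0 \<le> d"
  then have "p * d \<le> d * (p + 1)" "p + 1 > 0" by (auto simp: algebra_simps)
  then show ?thesis by (simp add: pos_divide_le_eq)
qed

text \<open>The integrand is at most |\<nu>| A B, where A^2 is the weighted L^2 density and B^2 =
  |x|^(-N) t^(2 \<gamma>), whose integral over n \<le> t \<le> 2n is of order n^(2 \<gamma> + 1).
  Pointwise AM-GM with a weight \<open>\<kappa>\<close> plays the role of Cauchy-Schwarz, and the
  exponent \<gamma> + 1/2 equals 3/2 - \<beta>.\<close>

lemma mass_bound: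
  fixes u :: "'a::euclidean_space \<Rightarrow> real" and \<nu> :: 'a
  assumes unn: "AE x in lebesgue_on (half_ball \<nu> R). u x \<ge> 0"
    and u: "u \<in> weighted_L2 (half_ball \<nu> R) (log_weight \<gamma>)" and R: "R \<le> 1"
  defines "I \<equiv> \<lambda>n x. u x * (indicator {real n..2 * real n} (- ln (norm x)) *
      ((\<nu> \<bullet> x) * norm x powr (- real DIM('a) / 2 - 2)))"
  shows "\<And>n. n \<ge> 1 \<Longrightarrow> integrable (lebesgue_on (half_ball \<nu> R)) (I n)"
    and "\<And>\<delta>. \<delta> > 0 \<Longrightarrow> \<exists>n0. \<forall>n\<ge>n0. (LINT x|lebesgue_on (half_ball \<nu> R). I n x) \<le> \<delta> * real n powr (\<gamma> + 1/2)"
proof -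
  let ?\<Omega> = "half_ball \<nu> R"
  let ?M = "lebesgue_on ?\<Omega>"
  define N where "N = real DIM('a)"
  have \<Omega>: "?\<Omega> \<in> sets lebesgue" using half_ball_measurable by blast
  have spM: "space ?M = ?\<Omega>" using \<Omega> by (simp add: space_restrict_space)
  have iw: "integrable ?M (\<lambda>x. (u x)\<^sup>2 * log_weight \<gamma> x)"
    using \<Omega> by (intro integrable_weighted_square[OF u]) (auto simp: power_int_minus)
  have tm: "(\<lambda>x. - ln (norm x)) \<in> borel_measurable ?M"
    by (rule borel_measurable_lebesgue_on) measurable
  show iI: "integrable ?M (I n)" if "n \<ge> 1" for n unfolding I_def
  proof (rule integrable_annulus[OF u R, of "real n" "2 * real n"])
    have mem: "- ln (norm x) \<in> {real n..2 * real n} \<longleftrightarrow> exp (- (2 * real n)) \<le> norm x \<and> norm x \<le> exp (- real n)"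
      if "norm x > 0" for x :: 'a
    proof -
      define s where "s = ln (norm x)"
      have e: "norm x = exp s" using that by (simp add: s_def)
      have "- s \<in> {real n..2 * real n} \<longleftrightarrow> exp (- (2 * real n)) \<le> exp s \<and> exp s \<le> exp (- real n)"
        by auto
      then show ?thesis unfolding e[symmetric] unfolding s_def .
    qed
    have pos: "norm x > 0" if "exp (- (2 * real n)) \<le> norm x" for x :: 'a
      using that exp_gt_zero[of "- (2 * real n)"] by linarith
    show "continuous_on {x::'a. exp (- (2 * real n)) \<le> norm x \<and> norm x \<le> exp (- real n)}
      (\<lambda>x. indicator {real n..2 * real n} (- ln (norm x)) * ((\<nu> \<bullet> x) * norm x powr (- real DIM('a) / 2 - 2)))"
    proof (rule continuous_on_eq)
      show "continuous_on {x::'a. exp (- (2 * real n)) \<le> norm x \<and> norm x \<le> exp (- real n)}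
        (\<lambda>x. (\<nu> \<bullet> x) * norm x powr (- real DIM('a) / 2 - 2))"
        by (intro continuous_intros) (auto dest: pos)
      fix x :: 'a assume "x \<in> {x. exp (- (2 * real n)) \<le> norm x \<and> norm x \<le> exp (- real n)}"
      then have "- ln (norm x) \<in> {real n..2 * real n}" using mem[OF pos] by blast
      then show "(\<nu> \<bullet> x) * norm x powr (- real DIM('a) / 2 - 2) =
          indicator {real n..2 * real n} (- ln (norm x)) * ((\<nu> \<bullet> x) * norm x powr (- real DIM('a) / 2 - 2))"
        by (simp only: indicator_simps mult_1)
    qed
    show "indicator {real n..2 * real n} (- ln (norm x)) * ((\<nu> \<bullet> x) * norm x powr (- real DIM('a) / 2 - 2)) = 0"
      if "x \<in> ?\<Omega>" "norm x < exp (- (2 * real n)) \<or> exp (- real n) < norm x" for x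
    proof -
      have "- ln (norm x) \<notin> {real n..2 * real n}"
        using mem[OF half_ball_norm(1)[OF that(1) R]] that(2) by linarith
      then have "indicat_real {real n..2 * real n} (- ln (norm x)) = 0" by (rule indicator_simps(2))
      then show ?thesis by (simp only: mult_zero_left)
    qed
  qed (use that in simp)
  fix \<delta> :: real assume \<delta>: "\<delta> > 0"
  \<comment> \<open>Bounds (t/n)^(2 \<gamma>) for n \<le> t \<le> 2n, whatever the sign of
    \<gamma>.\<close>
  define C where "C = max 1 (2 powr (2 * \<gamma>))"
  define Q where "Q = C * (2 * unit_ball_vol N * exp N)"
  \<comment> \<open>Fixed before n: it makes the part coming from B at most \<delta>, after which
    the tail \<open>E n\<close> is taken small relative to it. The factor 1/2 of AM-GM absorbs
    having two such parts.\<close>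
  define \<eta> where "\<eta> = \<delta> / (norm \<nu> * Q + 1)"
  have C: "C > 0" by (simp add: C_def)
  have Q: "Q \<ge> 0" using C by (simp add: Q_def N_def)
  have \<eta>: "\<eta> > 0" using \<delta> Q by (simp add: \<eta>_def add_nonneg_pos)
  have \<eta>Q: "norm \<nu> * Q * \<eta> \<le> \<delta>"
    unfolding \<eta>_def using \<delta> Q by (intro mult_divide_add_one_le) auto
  define E where "E n = (LINT x|?M. indicator {real n..} (- ln (norm x)) * ((u x)\<^sup>2 * log_weight \<gamma> x))" for n
  have E: "E \<longlonglongrightarrow> 0" unfolding E_def by (rule weighted_tail_tendsto_0[OF iw tm])
  have "(\<lambda>n. norm \<nu> * E n / \<eta>) \<longlonglongrightarrow> norm \<nu> * 0 / \<eta>" by (intro tendsto_intros E) (use \<eta> in auto)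
  then have "\<forall>\<^sub>F n in sequentially. norm \<nu> * E n / \<eta> < \<delta>" using \<delta> by (intro order_tendstoD) auto
  then obtain n1 where n1: "\<And>n. n \<ge> n1 \<Longrightarrow> norm \<nu> * E n / \<eta> < \<delta>" unfolding eventually_sequentially by blast
  show "\<exists>n0. \<forall>n\<ge>n0. (LINT x|?M. I n x) \<le> \<delta> * real n powr (\<gamma> + 1/2)"
  proof (intro exI[of _ "max n1 1"] allI impI)
    fix n assume "max n1 1 \<le> n"
    then have n: "n \<ge> n1" "n \<ge> 1" by auto
    define S where "S x = (\<Sum>k=n..2 * n. exp (real DIM('a) * (real k + 1)) * indicator (cball 0 (exp (- real k))) x)" for x :: 'a
    note S = shell_sum_integral[OF \<Omega> n(2), folded S_def]
    define T where "T x = indicator {real n..} (- ln (norm x)) * ((u x)\<^sup>2 * log_weight \<gamma> x)" for x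
    have iT: "integrable ?M T"
      unfolding T_def
      by (rule Bochner_Integration.integrable_bound[OF iw])
         (use tm borel_measurable_integrable[OF iw] in \<open>auto simp: indicator_def intro!: borel_measurable_times borel_measurable_indicator'\<close>)
    \<comment> \<open>This weight gives both halves of AM-GM the common factor n^(\<gamma> + 1/2):
      the A part becomes \<open>E n\<close> / \<open>\<eta>\<close>, the B part Q
      \<open>\<eta>\<close>.\<close>
    define \<kappa> where "\<kappa> = real n powr (\<gamma> + 1/2) / \<eta>"
    have \<kappa>: "\<kappa> > 0" using n \<eta> by (simp add: \<kappa>_def)
    define m where "m = C * real n powr (2 * \<gamma>) / \<kappa>"
    have m: "m \<ge> 0" using C \<kappa> by (simp add: m_def)
    have S0: "S x \<ge> 0" for x by (simp add: S_def sum_nonneg)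
    have T0: "T x \<ge> 0" for x by (simp add: T_def indicator_def)
    have pt: "I n x \<le> norm \<nu> / 2 * (\<kappa> * T x + m * S x)" if x: "x \<in> ?\<Omega>" and ux: "u x \<ge> 0" for x
    proof (cases "- ln (norm x) \<in> {real n..2 * real n}")
      case False
      then show ?thesis using \<kappa> m S0 T0 by (simp add: I_def)
    next
      case True
      note nx = half_ball_norm[OF x R]
      define t where "t = - ln (norm x)"
      have t: "real n \<le> t" "t \<le> 2 * real n" "t > 0" using True n by (auto simp: t_def)
      have at: "\<bar>ln (norm x)\<bar> = t" using nx by (simp add: t_def)
      define A where "A = u x * norm x powr (-1) * t powr (- \<gamma>)"
      define B where "B = norm x powr (- N / 2) * t powr \<gamma>"
      have sq: "(r powr c)\<^sup>2 = r powr (2 * c)" for r c :: real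
        by (simp add: power2_eq_square powr_add[symmetric])
      have A2: "A\<^sup>2 = T x"
      proof -
        have p: "norm x powr (2 * (-1)) = norm x powi (-2)" "2 * (- \<gamma>) = -2 * \<gamma>"
          using nx by (simp_all add: powr_minus power_int_minus powr_numeral)
        have "A\<^sup>2 = (u x)\<^sup>2 * (norm x powi (-2) * t powr (-2 * \<gamma>))"
          unfolding A_def power_mult_distrib sq mult.assoc p ..
        then show ?thesis using t by (simp add: T_def at) (simp add: t_def)
      qed
      have tg: "t powr (2 * \<gamma>) \<le> C * real n powr (2 * \<gamma>)"
      proof (cases "\<gamma> \<ge> 0")
        case True
        have "t powr (2 * \<gamma>) \<le> (2 * real n) powr (2 * \<gamma>)" using t True by (intro powr_mono2) auto
        also have "\<dots> = 2 powr (2 * \<gamma>) * real n powr (2 * \<gamma>)" by (simp add: powr_mult)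
        also have "\<dots> \<le> C * real n powr (2 * \<gamma>)" by (intro mult_right_mono) (auto simp: C_def)
        finally show ?thesis .
      next
        case False
        have "t powr (2 * \<gamma>) \<le> real n powr (2 * \<gamma>)" using t n False by (intro powr_mono2') auto
        also have "\<dots> \<le> C * real n powr (2 * \<gamma>)" using mult_right_mono[of 1 C "real n powr (2 * \<gamma>)"] by (simp add: C_def)
        finally show ?thesis .
      qed
      have "norm x powr (- N) \<le> S x"
        unfolding S_def N_def by (rule shell_cover) (use nx True in auto)
      then have "norm x powr (- N) * t powr (2 * \<gamma>) \<le> S x * (C * real n powr (2 * \<gamma>))"
        using tg S0 by (intro mult_mono) auto
      moreover have "B\<^sup>2 = norm x powr (- N) * t powr (2 * \<gamma>)"
        by (simp add: B_def power_mult_distrib sq)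
      ultimately have B2: "B\<^sup>2 / \<kappa> \<le> m * S x" using \<kappa> by (simp add: m_def field_simps)
      have "0 \<le> (\<kappa> * A - B)\<^sup>2 / \<kappa>" using \<kappa> by simp
      also have "\<dots> = \<kappa> * A\<^sup>2 + B\<^sup>2 / \<kappa> - 2 * (A * B)" using \<kappa> by (simp add: power2_eq_square field_simps)
      finally have AB: "2 * (A * B) \<le> \<kappa> * T x + m * S x" using B2 A2 by simp
      have "(\<nu> \<bullet> x) * norm x powr (- N / 2 - 2) \<le> (norm \<nu> * norm x) * norm x powr (- N / 2 - 2)"
        by (intro mult_right_mono norm_cauchy_schwarz) auto
      also have "\<dots> = norm \<nu> * (norm x powr (-1) * norm x powr (- N / 2))"
      proof -
        have "norm x * norm x powr (- N / 2 - 2) = norm x powr (1 + (- N / 2 - 2))"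
          unfolding powr_add using nx by simp
        also have "1 + (- N / 2 - 2) = -1 + - N / 2" by simp
        finally show ?thesis by (simp only: powr_add mult.assoc)
      qed
      finally have "u x * ((\<nu> \<bullet> x) * norm x powr (- N / 2 - 2)) \<le> u x * (norm \<nu> * (norm x powr (-1) * norm x powr (- N / 2)))"
        using ux by (rule mult_left_mono)
      also have "\<dots> = norm \<nu> * (A * B)"
        using t by (simp add: A_def B_def powr_minus field_simps)
      also have "\<dots> \<le> norm \<nu> / 2 * (\<kappa> * T x + m * S x)"
        using mult_left_mono[OF AB norm_ge_zero[of \<nu>]] by simp
      finally show ?thesis using True by (simp add: I_def N_def)
    qed
    have "(LINT x|?M. I n x) \<le> (LINT x|?M. norm \<nu> / 2 * (\<kappa> * T x + m * S x))"
    proof (rule integral_mono_AE[OF iI[OF n(2)]])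
      show "integrable ?M (\<lambda>x. norm \<nu> / 2 * (\<kappa> * T x + m * S x))"
        by (intro integrable_mult_right Bochner_Integration.integrable_add iT S)
      show "AE x in ?M. I n x \<le> norm \<nu> / 2 * (\<kappa> * T x + m * S x)"
        using unn AE_space by eventually_elim (use pt in \<open>simp add: spM\<close>)
    qed
    also have "\<dots> = norm \<nu> / 2 * (\<kappa> * E n + m * (LINT x|?M. S x))"
      using iT S(1) unfolding E_def T_def[symmetric] by simp
    also have "\<dots> \<le> norm \<nu> / 2 * (\<kappa> * E n + m * (2 * unit_ball_vol N * exp N * real n))"
      using S(2) m by (intro mult_left_mono add_left_mono) (auto simp: N_def)
    also have "m * (2 * unit_ball_vol N * exp N * real n) = real n powr (\<gamma> + 1/2) * (Q * \<eta>)"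
    proof -
      have "real n powr (2 * \<gamma>) * real n = real n powr (\<gamma> + 1/2) * real n powr (\<gamma> + 1/2)"
      proof -
        have "real n powr (2 * \<gamma>) * real n = real n powr (2 * \<gamma> + 1)" using n by (simp add: powr_add)
        also have "2 * \<gamma> + 1 = (\<gamma> + 1/2) + (\<gamma> + 1/2)" by simp
        finally show ?thesis by (simp only: powr_add)
      qed
      then have "real n powr (2 * \<gamma>) * real n / \<kappa> = real n powr (\<gamma> + 1/2) * \<eta>"
        using n \<eta> by (simp add: \<kappa>_def)
      then have "m * real n = C * (real n powr (\<gamma> + 1/2) * \<eta>)" by (simp add: m_def mult.assoc flip: times_divide_eq_right)
      then show ?thesis by (simp add: Q_def mult_ac)
    qed
    also have "norm \<nu> / 2 * (\<kappa> * E n + real n powr (\<gamma> + 1/2) * (Q * \<eta>))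
        = real n powr (\<gamma> + 1/2) * ((norm \<nu> * E n / \<eta> + norm \<nu> * Q * \<eta>) / 2)"
      by (simp add: \<kappa>_def field_simps)
    also have "\<dots> \<le> real n powr (\<gamma> + 1/2) * \<delta>"
      using n1[OF n(1)] \<eta>Q by (intro mult_left_mono) auto
    finally show "(LINT x|?M. I n x) \<le> \<delta> * real n powr (\<gamma> + 1/2)" by (simp add: mult.commute)
  qed
qed

text \<open>Inserting the truncated subsolution into the radial inequality bounds the integral of u
  times a weight, positive for a < t < a + 1, by the masses on [k, 2k] and [l, 2l]. Both
  contributions can be made arbitrarily small.\<close>

lemma vanishing_on_shell:
  fixes u :: "'a::euclidean_space \<Rightarrow> real" and \<nu> :: 'a
  assumes sol: "distributional_solution (half_ball \<nu> R) \<alpha> u"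
    and unn: "AE x in lebesgue_on (half_ball \<nu> R). u x \<ge> 0"
    and u: "u \<in> weighted_L2 (half_ball \<nu> R) (log_weight \<gamma>)"
    and R: "R \<le> 1" and \<gamma>: "\<gamma> \<le> 1" and \<alpha>: "\<alpha> \<ge> 1/4 - (1 - \<gamma>)\<^sup>2"
    and a: "0 < a" "exp (-a) < R"
  shows "AE x in lebesgue_on (half_ball \<nu> R). a < - ln (norm x) \<and> - ln (norm x) < a + 1 \<longrightarrow> u x = 0"
proof -
  let ?\<Omega> = "half_ball \<nu> R"
  let ?M = "lebesgue_on ?\<Omega>"
  define \<beta> where "\<beta> = 1 - \<gamma>"
  have \<beta>: "\<beta> \<ge> 0" using \<gamma> by (simp add: \<beta>_def)
  have \<Omega>: "?\<Omega> \<in> sets lebesgue" using half_ball_measurable by blast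
  have spM: "space ?M = ?\<Omega>" using \<Omega> by (simp add: space_restrict_space)
  obtain s :: "real \<Rightarrow> real" where s: "smooth_real UNIV s" "\<And>t. deriv s t \<ge> 0"
    "\<And>t. 0 < t \<Longrightarrow> t < 1 \<Longrightarrow> deriv s t > 0" "\<And>t. t \<le> 0 \<or> 1 \<le> t \<Longrightarrow> deriv s t = 0"
    "\<And>t. t \<le> 0 \<Longrightarrow> s t = 0" "\<And>t. t \<ge> 1 \<Longrightarrow> s t = 1" "\<And>t. s t \<ge> 0" "\<And>t. s t \<le> 1"
    using smooth_step_exists by metis
  have c1: "continuous_on UNIV (deriv s)"
    by (intro smooth_real_continuous smooth_real_deriv s)
  have c2: "continuous_on UNIV (deriv (deriv s))"
    by (intro smooth_real_continuous smooth_real_deriv s)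
  have s1: "deriv s t = 0" if "t < 0 \<or> 1 < t" for t using s(4)[of t] that by auto
  have s2: "deriv (deriv s) t = 0" if "t < 0 \<or> 1 < t" for t
    by (rule deriv_eq_0_outside[OF s1 that])
  obtain B1 where B1: "\<And>t. \<bar>deriv s t\<bar> \<le> B1"
    using bounded_if_zero_outside[OF c1 s1] by blast
  obtain B2 where B2: "\<And>t. \<bar>deriv (deriv s) t\<bar> \<le> B2"
    using bounded_if_zero_outside[OF c2 s2] by blast
  define B where "B = max B1 B2"
  have B: "deriv s t \<le> B" "\<bar>deriv (deriv s) t\<bar> \<le> B" for t
    using abs_le_D1[OF B1[of t]] B2[of t] unfolding B_def by linarith+
  have B0: "B \<ge> 0" using B(2)[of 0] by linarith
  define g where "g x = (\<nu> \<bullet> x) * norm x powr (- real DIM('a) / 2 - 2)" for x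
  \<comment> \<open>The leading part of the lower bound in \<open>truncated_subsolution\<close>,
    multiplied by the spatial weight.\<close>
  define h where "h x = g x * ((- ln (norm x)) powr (-1/2 - \<beta>) * deriv s (- ln (norm x) - a))" for x
  define I where "I n x = u x * (indicator {real n..2 * real n} (- ln (norm x)) * g x)" for n x
  have mb1: "integrable ?M (I n)" if "n \<ge> 1" for n
    using mass_bound(1)[OF unn u R that] unfolding I_def g_def .
  have mb2: "\<exists>n0. \<forall>n\<ge>n0. (LINT x|?M. I n x) \<le> \<delta> * real n powr (\<gamma> + 1/2)" if "\<delta> > 0" for \<delta>
    using mass_bound(2)[OF unn u R that] unfolding I_def g_def .
  have g0: "g x \<ge> 0" if "x \<in> ?\<Omega>" for x using that by (simp add: g_def half_ball_def)
  have pos: "norm x > 0" "- ln (norm x) > 0" if "exp (- (a + 1)) \<le> norm x \<and> norm x \<le> exp (-a)" for x :: 'a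
  proof -
    show 1: "norm x > 0" using that exp_gt_zero[of "- (a + 1)"] by linarith
    have "exp (-a) < 1" using a by simp
    then have "norm x < 1" using that by linarith
    then show "- ln (norm x) > 0" using 1 by simp
  qed
  have nz: "norm x \<noteq> 0" "- ln (norm x) \<noteq> 0"
    if "exp (- (a + 1)) \<le> norm x \<and> norm x \<le> exp (-a)" for x :: 'a
    using pos[OF that] by linarith+
  have cs: "continuous_on S (\<lambda>x. deriv s (f x))" if "continuous_on S f" for S and f :: "'a \<Rightarrow> real"
    by (rule continuous_on_compose2[OF c1 that]) auto
  have cont: "continuous_on {x::'a. exp (- (a + 1)) \<le> norm x \<and> norm x \<le> exp (-a)} h"
    unfolding h_def g_def
    by (intro continuous_intros cs) (use nz in blast)+
  have ih: "integrable ?M (\<lambda>x. u x * h x)"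
  proof (rule integrable_annulus[OF u R a(1) cont])
    fix x :: 'a assume x: "x \<in> ?\<Omega>" "norm x < exp (- (a + 1)) \<or> exp (-a) < norm x"
    have nx: "norm x > 0" using half_ball_norm[OF x(1) R] by simp
    then have e: "norm x = exp (ln (norm x))" by simp
    have "ln (norm x) < - (a + 1) \<or> - a < ln (norm x)"
      using x(2) by (subst (asm) (1 2) e) (simp only: exp_less_cancel_iff)
    then have "deriv s (- ln (norm x) - a) = 0" by (intro s(4)) linarith
    then show "h x = 0" by (simp add: h_def)
  qed
  \<comment> \<open>The order of choices matters: k depends on \<open>\<delta>\<close>, the constant
    \<open>C'\<close> on k, then \<open>\<epsilon>\<close> on \<open>C'\<close>, and only last l on
    \<open>\<epsilon>\<close>.\<close>
  have key: "(LINT x|?M. u x * h x) \<le> \<delta> * B + \<delta>" if \<delta>: "\<delta> > 0" for \<delta>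
  proof -
    obtain k0 where k0: "\<And>n. n \<ge> k0 \<Longrightarrow> (LINT x|?M. I n x) \<le> \<delta> * real n powr (\<gamma> + 1/2)"
      using mb2[OF \<delta>] by blast
    obtain k1 where k1: "a + 1 \<le> real k1" using real_arch_simple by blast
    define k where "k = max k0 k1"
    have k: "k \<ge> k0" "real k \<ge> a + 1" using k1 by (auto simp: k_def)
    have k_ge1: "k \<ge> 1" using k(2) a by (cases k) auto
    obtain C' where C': "C' \<ge> 0" and trunc: "\<And>L. L \<ge> 2 * real k \<Longrightarrow> \<exists>\<psi>. smooth_real UNIV \<psi> \<and> (\<forall>t. \<psi> t \<ge> 0) \<and>
      (\<forall>t. t \<le> a \<or> 2 * L \<le> t \<longrightarrow> \<psi> t = 0) \<and>
      (\<forall>t>0. deriv (deriv \<psi>) t + (1/4 - \<beta>\<^sup>2) / t\<^sup>2 * \<psi> t \<ge>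
        t powr (-1/2 - \<beta>) * deriv s (t - a) - B * real k powr (-3/2 - \<beta>) * indicator {real k..2 * real k} t
        - C' * L powr (\<beta> - 3/2) * indicator {L..2 * L} t)"
      using truncated_subsolution[OF s(1,2,4,5,6,7,8) B \<beta> a(1) k(2)] by blast
    define \<epsilon> where "\<epsilon> = \<delta> / (C' + 1)"
    have \<epsilon>: "\<epsilon> > 0" "C' * \<epsilon> \<le> \<delta>"
      using \<delta> C' mult_divide_add_one_le[of C' \<delta>] by (auto simp: \<epsilon>_def)
    obtain l0 where l0: "\<And>n. n \<ge> l0 \<Longrightarrow> (LINT x|?M. I n x) \<le> \<epsilon> * real n powr (\<gamma> + 1/2)"
      using mb2[OF \<epsilon>(1)] by blast
    define l where "l = max l0 (2 * k)"
    have l: "l \<ge> l0" "real l \<ge> 2 * real k" "l \<ge> 1" using k_ge1 by (auto simp: l_def)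
    obtain \<psi> where \<psi>: "smooth_real UNIV \<psi>" "\<And>t. \<psi> t \<ge> 0" "\<And>t. t \<le> a \<or> 2 * real l \<le> t \<Longrightarrow> \<psi> t = 0"
      and low: "\<And>t. t > 0 \<Longrightarrow> deriv (deriv \<psi>) t + (1/4 - \<beta>\<^sup>2) / t\<^sup>2 * \<psi> t \<ge>
        t powr (-1/2 - \<beta>) * deriv s (t - a) - B * real k powr (-3/2 - \<beta>) * indicator {real k..2 * real k} t
        - C' * real l powr (\<beta> - 3/2) * indicator {real l..2 * real l} t"
      using trunc[OF l(2)] by blast
    have \<alpha>': "1/4 - \<beta>\<^sup>2 \<le> \<alpha>" using \<alpha> by (simp add: \<beta>_def)
    note rad = radial_inequality[OF sol unn u R a \<alpha>' \<psi>, folded g_def]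
    define cK where "cK = B * real k powr (-3/2 - \<beta>)"
    define cL where "cL = C' * real l powr (\<beta> - 3/2)"
    have cK: "cK \<ge> 0" and cL: "cL \<ge> 0" using B0 C' by (auto simp: cK_def cL_def)
    have le: "(LINT x|?M. u x * h x - cK * I k x - cL * I l x) \<le>
      (LINT x|?M. u x * (g x * (deriv (deriv \<psi>) (- ln (norm x)) + (1/4 - \<beta>\<^sup>2) / (ln (norm x))\<^sup>2 * \<psi> (- ln (norm x)))))"
    proof (rule integral_mono_AE)
      show "integrable ?M (\<lambda>x. u x * h x - cK * I k x - cL * I l x)"
        by (intro Bochner_Integration.integrable_diff integrable_mult_right ih mb1 k_ge1 l)
      show "AE x in ?M. u x * h x - cK * I k x - cL * I l x \<le>
        u x * (g x * (deriv (deriv \<psi>) (- ln (norm x)) + (1/4 - \<beta>\<^sup>2) / (ln (norm x))\<^sup>2 * \<psi> (- ln (norm x))))"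
        using unn AE_space
      proof eventually_elim
        case (elim x)
        then have x: "x \<in> ?\<Omega>" by (simp add: spM)
        define t where "t = - ln (norm x)"
        have t: "t > 0" using half_ball_norm[OF x R] by (simp add: t_def)
        have t2: "(ln (norm x))\<^sup>2 = t\<^sup>2" by (simp add: t_def)
        have "u x * h x - cK * I k x - cL * I l x = (u x * g x) * (t powr (-1/2 - \<beta>) * deriv s (t - a)
            - cK * indicator {real k..2 * real k} t - cL * indicator {real l..2 * real l} t)"
          unfolding h_def I_def t_def[symmetric] by (simp only: algebra_simps)
        also have "\<dots> \<le> (u x * g x) * (deriv (deriv \<psi>) t + (1/4 - \<beta>\<^sup>2) / t\<^sup>2 * \<psi> t)"
          using low[OF t] elim(1) g0[OF x] unfolding cK_def cL_def by (intro mult_left_mono) auto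
        finally show ?case unfolding t2 unfolding t_def by (simp only: mult.assoc)
      qed
    qed (rule rad(1))
    also have "\<dots> \<le> 0" by (rule rad(2))
    also have "(LINT x|?M. u x * h x - cK * I k x - cL * I l x)
      = (LINT x|?M. u x * h x) - cK * (LINT x|?M. I k x) - cL * (LINT x|?M. I l x)"
      using ih mb1[OF k_ge1] mb1[OF l(3)] by simp
    finally have 1: "(LINT x|?M. u x * h x) \<le> cK * (LINT x|?M. I k x) + cL * (LINT x|?M. I l x)" by linarith
    have e: "\<gamma> + 1/2 = 3/2 - \<beta>" by (simp add: \<beta>_def)
    have "cK * (LINT x|?M. I k x) \<le> cK * (\<delta> * real k powr (3/2 - \<beta>))"
      using k0[OF k(1)] cK unfolding e by (rule mult_left_mono)
    also have "\<dots> = \<delta> * B * real k powr (- 2 * \<beta>)"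
    proof -
      have "real k powr (-3/2 - \<beta>) * real k powr (3/2 - \<beta>) = real k powr (- 2 * \<beta>)"
        unfolding powr_add[symmetric] by (rule arg_cong[where f = "\<lambda>r. _ powr r"]) simp
      then show ?thesis by (simp add: cK_def mult_ac)
    qed
    also have "\<dots> \<le> \<delta> * B * 1"
    proof (rule mult_left_mono)
      \<comment> \<open>For \<beta> = 0 this is an equality: k supplies no decay, and the smallness
        is that of \<open>\<delta>\<close>.\<close>
      have "real k powr (- 2 * \<beta>) \<le> real k powr 0" using k_ge1 \<beta> by (intro powr_mono) auto
      then show "real k powr (- 2 * \<beta>) \<le> 1" using k_ge1 by simp
    qed (use \<delta> B0 in simp)
    finally have 2: "cK * (LINT x|?M. I k x) \<le> \<delta> * B" by simp
    have "cL * (LINT x|?M. I l x) \<le> cL * (\<epsilon> * real l powr (3/2 - \<beta>))"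
      using l0[OF l(1)] cL unfolding e by (rule mult_left_mono)
    also have "\<dots> = C' * \<epsilon>"
    proof -
      \<comment> \<open>The powers of l cancel exactly, so \<open>\<epsilon>\<close> alone has to
        beat \<open>C'\<close>.\<close>
      have "real l powr (\<beta> - 3/2) * real l powr (3/2 - \<beta>) = 1"
        unfolding powr_add[symmetric] using l(3) by simp
      then show ?thesis by (simp add: cL_def mult_ac)
    qed
    finally have 3: "cL * (LINT x|?M. I l x) \<le> \<delta>" using \<epsilon>(2) by linarith
    show ?thesis using 1 2 3 by linarith
  qed
  have "(LINT x|?M. u x * h x) \<le> 0"
  proof (rule field_le_epsilon)
    fix e :: real assume e: "e > 0"
    have "e / (B + 1) * B + e / (B + 1) = e / (B + 1) * (B + 1)" by (simp only: distrib_left mult_1_right)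
    also have "\<dots> = e" using B0 by simp
    finally show "(LINT x|?M. u x * h x) \<le> 0 + e"
      using key[of "e / (B + 1)"] e B0 by simp
  qed
  moreover have hnn: "AE x in ?M. 0 \<le> u x * h x"
    using unn AE_space by eventually_elim (use g0 s(2) in \<open>simp add: spM h_def\<close>)
  moreover have "(LINT x|?M. u x * h x) \<ge> 0" by (rule integral_nonneg_AE[OF hnn])
  ultimately have "AE x in ?M. u x * h x = 0"
    using integral_nonneg_eq_0_iff_AE[OF ih hnn] by linarith
  then show ?thesis
    using AE_space
  proof eventually_elim
    case (elim x)
    then have x: "x \<in> ?\<Omega>" by (simp add: spM)
    note nx = half_ball_norm[OF x R]
    show ?case
    proof
      assume t: "a < - ln (norm x) \<and> - ln (norm x) < a + 1"
      have "deriv s (- ln (norm x) - a) > 0" using t by (intro s(3)) auto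
      moreover have "(- ln (norm x)) powr (-1/2 - \<beta>) > 0" using nx by simp
      moreover have "g x > 0" using x nx by (simp add: g_def half_ball_def)
      ultimately have "h x > 0" by (simp add: h_def)
      with elim(1) show "u x = 0" by simp
    qed
  qed
qed

theorem theorem0p2:
  fixes u :: "'a::euclidean_space \<Rightarrow> real" and \<nu> :: 'a and R \<alpha> :: real
  assumes "0 < R" "R \<le> 1"
    and "\<nu> \<noteq> 0"
    and "distributional_solution (half_ball \<nu> R) \<alpha> u"
    and "AE x in lebesgue_on (half_ball \<nu> R). u x \<ge> 0"
    and "\<exists>\<gamma>\<le>1.
           u \<in> weighted_L2 (half_ball \<nu> R)
                 (\<lambda>x. norm x powi (-2) * \<bar>ln (norm x)\<bar> powr (-2 * \<gamma>)) \<and>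
           \<alpha> \<ge> 1 / 4 - (1 - \<gamma>)\<^sup>2"
  shows "AE x in lebesgue_on (half_ball \<nu> R). u x = 0"
proof -
  let ?M = "lebesgue_on (half_ball \<nu> R)"
  obtain \<gamma> where \<gamma>: "\<gamma> \<le> 1" "u \<in> weighted_L2 (half_ball \<nu> R) (log_weight \<gamma>)"
    "\<alpha> \<ge> 1 / 4 - (1 - \<gamma>)\<^sup>2"
    using assms(6) by blast
  have spM: "space ?M = half_ball \<nu> R"
    using half_ball_measurable[of \<nu> R] by (simp add: space_restrict_space fmeasurableD)
  \<comment> \<open>Rational inner levels suffice to cover the half ball by shells, and they keep
    the union of exceptional null sets countable.\<close>
  have "AE x in ?M. \<forall>a\<in>{a\<in>\<rat>. 0 < a \<and> exp (-a) < R}. a < - ln (norm x) \<and> - ln (norm x) < a + 1 \<longrightarrow> u x = 0"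
  proof (rule AE_ball_countable')
    show "countable {a\<in>\<rat>. 0 < a \<and> exp (-a) < R}"
      by (rule countable_subset[OF _ countable_rat]) auto
  qed (use vanishing_on_shell[OF assms(4,5) \<gamma>(2) assms(2) \<gamma>(1,3)] in blast)
  then show ?thesis
    using AE_space
  proof eventually_elim
    case (elim x)
    then have x: "x \<in> half_ball \<nu> R" by (simp add: spM)
    note nx = half_ball_norm[OF x assms(2)]
    define t where "t = - ln (norm x)"
    have "ln (norm x) < ln R" using nx assms(1) by simp
    \<comment> \<open>A level above t - 1 and below t has t in its shell; a level above -ln R \<ge>
      0 is positive and satisfies exp(-a) < R.\<close>
    then have "max (- ln R) (t - 1) < t" by (simp add: t_def)
    then obtain a where a: "a \<in> \<rat>" "max (- ln R) (t - 1) < a" "a < t"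
      using Rats_dense_in_real by blast
    have "ln R \<le> 0" using assms(1,2) by simp
    then have "0 < a" using a(2) by linarith
    moreover have "exp (-a) < R"
    proof -
      have "- a < ln R" using a(2) by simp
      then have "exp (- a) < exp (ln R)" by simp
      then show ?thesis using assms(1) by simp
    qed
    ultimately show ?case using elim(1) a by (auto simp: t_def)
  qed
qed

end
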